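(* Let $(X,\sigma)$ be a weakly RI-compatible left non-degenerate braided set. Let $(M,\cdot)$ be a solid right module and $(N,\cdot)$ a left module over $(X,\sigma)$. Then the pre-cubical structure $(M\times X^{\times k}\times N,\;d^+_i=d'_i,\;d^-_i=d_i)$ can be enriched into a semi-strong skew cubical one by the degeneracies $$s_i\colon(m,y_1,\dots,y_k,n)\mapsto\bigl(m\cdot t(\chi_i(y_1,\dots,y_k))^{-1},\;y_1,\dots,y_{i-1},y_i,y_i,y_{i+1},\dots,y_k,\;n\bigr).$$ Further, given an abelian group $A$, the abelian groups $C_k(X,M,N;A)=A(M\times X^{\times k}\times N)$ (formal $A$-linear combinations of elements of $M\times X^{\times k}\times N$), $k\geqslant0$, decompose as $$C_k(X,M,N;A)=C^{\mathrm D}_k(X,M,N;A)\oplus C^{\mathrm N}_k(X,M,N;A),$$ $$C^{\mathrm D}_k(X,M,N;A)=\sum_{i=1}^{k-1}A\operatorname{Im}s_i,\qquad C^{\mathrm N}_k(X,M,N;A)=\operatorname{Im}\eta_k,$$ where $\eta_k$ is the $A$-linearization of $(\mathrm{Id}-s_1d'_2)(\mathrm{Id}-s_2d'_3)\cdots(\mathrm{Id}-s_{k-1}d'_k)$. For any $\alpha,\beta\in\mathbb Z$, this decomposition is preserved by the differentials $$\partial^{(\alpha,\beta)}_k=\alpha\sum_{i=1}^k(-1)^{i-1}d'_i+\beta\sum_{i=1}^k(-1)^{i-1}d_i.$$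
   Context: A braided set is a set $X$ with a (not necessarily invertible) map $\sigma\colon X\times X\to X\times X$, $\sigma(a,b)=({}^{a}b,a^b)$, satisfying the Yang--Baxter equation $(\sigma\times\mathrm{Id})(\mathrm{Id}\times\sigma)(\sigma\times\mathrm{Id})=(\mathrm{Id}\times\sigma)(\sigma\times\mathrm{Id})(\mathrm{Id}\times\sigma)$. It is left non-degenerate if for every $b\in X$ the map $a\mapsto a^b$ is bijective; then $a\mapsto b\,\tilde{\cdot}\,a$ denotes its inverse, and $a\cdot b={}^{(b\,\tilde{\cdot}\,a)}b$ for $a,b\in X$. It is weakly RI-compatible if there is a map $t\colon X\to X$ with $\sigma(t(a),a)=(t(a),a)$ for all $a$; in the left non-degenerate case this is equivalent to $a\cdot a=a\,\tilde{\cdot}\,a$ for all $a$, and necessarily $t(a)=a\cdot a$. Put $a\triangleleft_\sigma b=(b\cdot a)^b$. A right module over $(X,\sigma)$ is a set $M$ with a map $M\times X\to M$, $(m,a)\mapsto m\cdot a$, such that $(m\cdot a)\cdot b=(m\cdot{}^{a}b)\cdot a^b$; it is solid if every $a\in X$ acts on $M$ bijectively, and then $m\mapsto m\cdot a^{-1}$ denotes the inverse of $m\mapsto m\cdot a$. A left module is a set $N$ with a map $X\times N\to N$, $(a,n)\mapsto a\cdot n$, such that $a\cdot(b\cdot n)={}^{a}b\cdot(a^b\cdot n)$. The $k$-guitar map $J\colon X^{\times k}\to X^{\times k}$, $J(x_1,\dots,x_k)=(J_1,\dots,J_k)$, $J_i=(\cdots(x_i^{x_{i+1}})\cdots)^{x_k}$,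 is bijective; write $J^{-1}=(J^{-1}_1,\dots,J^{-1}_k)$ and $$\chi_i(y_1,\dots,y_k)=J_1^{-1}\bigl((\cdots(y_i\triangleleft_\sigma y_{i-1})\cdots)\triangleleft_\sigma y_1,\;y_1,\dots,y_{i-1},y_{i+1},\dots,y_k\bigr).$$ The boundaries $M\times X^{\times k}\times N\to M\times X^{\times(k-1)}\times N$ ($1\leqslant i\leqslant k$) are $$d_i\colon(m,y_1,\dots,y_k,n)\mapsto(m,y_i\,\tilde{\cdot}\,y_1,\dots,y_i\,\tilde{\cdot}\,y_{i-1},y_i\cdot y_{i+1},\dots,y_i\cdot y_k,y_i\cdot n),$$ $$d'_i\colon(m,y_1,\dots,y_k,n)\mapsto(m\cdot\chi_i(y_1,\dots,y_k),y_1,\dots,y_{i-1},y_{i+1},\dots,y_k,n).$$ A pre-cubical structure: objects $C_k$ ($k\geqslant0$), morphisms $d^\pm_i\colon C_k\to C_{k-1}$ ($1\leqslant i\leqslant k$) with $d^\varepsilon_id^\zeta_j=d^\zeta_{j-1}d^\varepsilon_i$ for $i<j$, $\varepsilon,\zeta\in\{+,-\}$. It is semi-strong skew cubical if it also has morphisms (degeneracies) $s_i\colon C_k\to C_{k+1}$, $k\geqslant1$, $1\leqslant i\leqslant k$, with, for both $\varepsilon=\pm$: $d^\varepsilon_is_j=s_{j-1}d^\varepsilon_i$ ($i<j$), $d^\varepsilon_is_j=s_jd^\varepsilon_{i-1}$ ($i>j+1$), $d^\varepsilon_is_i=d^\varepsilon_{i+1}s_i$; and moreover $s_is_j=s_{j+1}s_i$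 ($i\leqslant j$) and $d^+_is_i=d^+_{i+1}s_i=\mathrm{Id}$. *)

theory Defs
  imports "HOL-Library.FuncSet" "HOL-Library.Poly_Mapping"
begin

section \<open>Braided sets\<close>

text \<open>For \<open>\<sigma> (a, b) = (\<^sup>ab, a\<^sup>b)\<close>, \<open>lpart \<sigma> a b\<close> is \<open>\<^sup>ab\<close> and \<open>rpart \<sigma> a b\<close> is \<open>a\<^sup>b\<close>.\<close>

definition lpart :: "('x \<times> 'x \<Rightarrow> 'x \<times> 'x) \<Rightarrow> 'x \<Rightarrow> 'x \<Rightarrow> 'x" where
  "lpart \<sigma> a b = fst (\<sigma> (a, b))"

definition rpart :: "('x \<times> 'x \<Rightarrow> 'x \<times> 'x) \<Rightarrow> 'x \<Rightarrow> 'x \<Rightarrow> 'x" where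
  "rpart \<sigma> a b = snd (\<sigma> (a, b))"

definition sigma_times_id :: "('x \<times> 'x \<Rightarrow> 'x \<times> 'x) \<Rightarrow> 'x \<times> 'x \<times> 'x \<Rightarrow> 'x \<times> 'x \<times> 'x" where
  "sigma_times_id \<sigma> = (\<lambda>(a, b, c). let (a', b') = \<sigma> (a, b) in (a', b', c))"

definition id_times_sigma :: "('x \<times> 'x \<Rightarrow> 'x \<times> 'x) \<Rightarrow> 'x \<times> 'x \<times> 'x \<Rightarrow> 'x \<times> 'x \<times> 'x" where
  "id_times_sigma \<sigma> = (\<lambda>(a, b, c). (a, \<sigma> (b, c)))"

definition braided_set :: "'x set \<Rightarrow> ('x \<times> 'x \<Rightarrow> 'x \<times> 'x) \<Rightarrow> bool" where
  "braided_set X \<sigma> \<longleftrightarrow>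
     \<sigma> \<in> X \<times> X \<rightarrow> X \<times> X \<and>
     (\<forall>v \<in> X \<times> X \<times> X.
        (sigma_times_id \<sigma> \<circ> id_times_sigma \<sigma> \<circ> sigma_times_id \<sigma>) v =
        (id_times_sigma \<sigma> \<circ> sigma_times_id \<sigma> \<circ> id_times_sigma \<sigma>) v)"

definition left_nondegenerate :: "'x set \<Rightarrow> ('x \<times> 'x \<Rightarrow> 'x \<times> 'x) \<Rightarrow> bool" where
  "left_nondegenerate X \<sigma> \<longleftrightarrow> (\<forall>b \<in> X. bij_betw (\<lambda>a. rpart \<sigma> a b) X X)"

text \<open>\<open>tdot X \<sigma> b a\<close> is the inverse image of \<open>a\<close> under \<open>c \<mapsto> c\<^sup>b\<close>; note the argument order.\<close>

definition tdot :: "'x set \<Rightarrow> ('x \<times> 'x \<Rightarrow> 'x \<times> 'x) \<Rightarrow> 'x \<Rightarrow> 'x \<Rightarrow> 'x" where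
  "tdot X \<sigma> b a = inv_into X (\<lambda>c. rpart \<sigma> c b) a"

definition dot :: "'x set \<Rightarrow> ('x \<times> 'x \<Rightarrow> 'x \<times> 'x) \<Rightarrow> 'x \<Rightarrow> 'x \<Rightarrow> 'x" where
  "dot X \<sigma> a b = lpart \<sigma> (tdot X \<sigma> b a) b"

definition tri :: "'x set \<Rightarrow> ('x \<times> 'x \<Rightarrow> 'x \<times> 'x) \<Rightarrow> 'x \<Rightarrow> 'x \<Rightarrow> 'x" where
  "tri X \<sigma> a b = rpart \<sigma> (dot X \<sigma> b a) b"

text \<open>The map \<open>t\<close> witnessing weak RI-compatibility is a parameter because the degeneracies use it.\<close>

definition weakly_RI_compatible :: "'x set \<Rightarrow> ('x \<times> 'x \<Rightarrow> 'x \<times> 'x) \<Rightarrow> ('x \<Rightarrow> 'x) \<Rightarrow> bool" where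
  "weakly_RI_compatible X \<sigma> t \<longleftrightarrow> t \<in> X \<rightarrow> X \<and> (\<forall>a \<in> X. \<sigma> (t a, a) = (t a, a))"

definition right_module ::
    "'x set \<Rightarrow> ('x \<times> 'x \<Rightarrow> 'x \<times> 'x) \<Rightarrow> 'm set \<Rightarrow> ('m \<Rightarrow> 'x \<Rightarrow> 'm) \<Rightarrow> bool" where
  "right_module X \<sigma> M ra \<longleftrightarrow>
     ra \<in> M \<rightarrow> X \<rightarrow> M \<and>
     (\<forall>m \<in> M. \<forall>a \<in> X. \<forall>b \<in> X. ra (ra m a) b = ra (ra m (lpart \<sigma> a b)) (rpart \<sigma> a b))"

definition solid_right_module ::
    "'x set \<Rightarrow> ('x \<times> 'x \<Rightarrow> 'x \<times> 'x) \<Rightarrow> 'm set \<Rightarrow> ('m \<Rightarrow> 'x \<Rightarrow> 'm) \<Rightarrow> bool" where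
  "solid_right_module X \<sigma> M ra \<longleftrightarrow>
     right_module X \<sigma> M ra \<and> (\<forall>a \<in> X. bij_betw (\<lambda>m. ra m a) M M)"

definition act_inverse :: "'m set \<Rightarrow> ('m \<Rightarrow> 'x \<Rightarrow> 'm) \<Rightarrow> 'm \<Rightarrow> 'x \<Rightarrow> 'm" where
  "act_inverse M ra m a = inv_into M (\<lambda>m'. ra m' a) m"

definition left_module ::
    "'x set \<Rightarrow> ('x \<times> 'x \<Rightarrow> 'x \<times> 'x) \<Rightarrow> 'n set \<Rightarrow> ('x \<Rightarrow> 'n \<Rightarrow> 'n) \<Rightarrow> bool" where
  "left_module X \<sigma> N la \<longleftrightarrow>
     la \<in> X \<rightarrow> N \<rightarrow> N \<and>
     (\<forall>n \<in> N. \<forall>a \<in> X. \<forall>b \<in> X. la a (la b n) = la (lpart \<sigma> a b) (la (rpart \<sigma> a b) n))"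


section \<open>Guitar map, boundaries and degeneracies\<close>

text \<open>A tuple \<open>(y\<^sub>1, \<dots>, y\<^sub>k)\<close> is a list of length \<open>k\<close>. Lists are indexed from \<open>0\<close>, so \<open>y\<^sub>i\<close> is
  \<open>ys ! (i - 1)\<close>, while boundaries and degeneracies keep their indices \<open>1 \<le> i \<le> k\<close>.\<close>

definition tuples :: "'x set \<Rightarrow> nat \<Rightarrow> 'x list set" where
  "tuples X k = {ys. set ys \<subseteq> X \<and> length ys = k}"

definition guitar :: "('x \<times> 'x \<Rightarrow> 'x \<times> 'x) \<Rightarrow> 'x list \<Rightarrow> 'x list" where
  "guitar \<sigma> xs = map (\<lambda>i. foldl (rpart \<sigma>) (xs ! i) (drop (Suc i) xs)) [0..<length xs]"

definition guitar_inv :: "'x set \<Rightarrow> ('x \<times> 'x \<Rightarrow> 'x \<times> 'x) \<Rightarrow> 'x list \<Rightarrow> 'x list" where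
  "guitar_inv X \<sigma> ys = inv_into (tuples X (length ys)) (guitar \<sigma>) ys"

definition chi :: "'x set \<Rightarrow> ('x \<times> 'x \<Rightarrow> 'x \<times> 'x) \<Rightarrow> nat \<Rightarrow> 'x list \<Rightarrow> 'x" where
  "chi X \<sigma> i ys =
     hd (guitar_inv X \<sigma>
          (foldl (tri X \<sigma>) (ys ! (i - 1)) (rev (take (i - 1) ys)) # take (i - 1) ys @ drop i ys))"

definition cells :: "'x set \<Rightarrow> 'm set \<Rightarrow> 'n set \<Rightarrow> nat \<Rightarrow> ('m \<times> 'x list \<times> 'n) set" where
  "cells X M N k = M \<times> tuples X k \<times> N"

definition bd :: "'x set \<Rightarrow> ('x \<times> 'x \<Rightarrow> 'x \<times> 'x) \<Rightarrow> ('x \<Rightarrow> 'n \<Rightarrow> 'n)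
    \<Rightarrow> nat \<Rightarrow> 'm \<times> 'x list \<times> 'n \<Rightarrow> 'm \<times> 'x list \<times> 'n" where
  "bd X \<sigma> la i = (\<lambda>(m, ys, n).
     let y = ys ! (i - 1) in
     (m, map (tdot X \<sigma> y) (take (i - 1) ys) @ map (dot X \<sigma> y) (drop i ys), la y n))"

definition bd' :: "'x set \<Rightarrow> ('x \<times> 'x \<Rightarrow> 'x \<times> 'x) \<Rightarrow> ('m \<Rightarrow> 'x \<Rightarrow> 'm)
    \<Rightarrow> nat \<Rightarrow> 'm \<times> 'x list \<times> 'n \<Rightarrow> 'm \<times> 'x list \<times> 'n" where
  "bd' X \<sigma> ra i = (\<lambda>(m, ys, n). (ra m (chi X \<sigma> i ys), take (i - 1) ys @ drop i ys, n))"

text \<open>\<open>take i ys @ drop (i - 1) ys\<close> is \<open>ys\<close> with \<open>y\<^sub>i\<close> repeated.\<close>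

definition degen :: "'x set \<Rightarrow> ('x \<times> 'x \<Rightarrow> 'x \<times> 'x) \<Rightarrow> 'm set \<Rightarrow> ('m \<Rightarrow> 'x \<Rightarrow> 'm) \<Rightarrow> ('x \<Rightarrow> 'x)
    \<Rightarrow> nat \<Rightarrow> 'm \<times> 'x list \<times> 'n \<Rightarrow> 'm \<times> 'x list \<times> 'n" where
  "degen X \<sigma> M ra t i = (\<lambda>(m, ys, n).
     (act_inverse M ra m (t (chi X \<sigma> i ys)), take i ys @ drop (i - 1) ys, n))"


section \<open>Cubical structures on sets\<close>

datatype sign = Pos | Neg

text \<open>\<open>d \<epsilon> k i\<close> is \<open>d\<^sup>\<epsilon>\<^sub>i\<close> on \<open>C k\<close>, and \<open>s k i\<close> is \<open>s\<^sub>i\<close> on \<open>C k\<close>. All identities are required only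
  on the sets \<open>C k\<close>, for those indices for which both sides are defined.\<close>

definition pre_cubical :: "(nat \<Rightarrow> 'c set) \<Rightarrow> (sign \<Rightarrow> nat \<Rightarrow> nat \<Rightarrow> 'c \<Rightarrow> 'c) \<Rightarrow> bool" where
  "pre_cubical C d \<longleftrightarrow>
     (\<forall>\<epsilon> k i. 1 \<le> i \<and> i \<le> k \<longrightarrow> d \<epsilon> k i \<in> C k \<rightarrow> C (k - 1)) \<and>
     (\<forall>\<epsilon> \<zeta> k i j. 1 \<le> i \<and> i < j \<and> j \<le> k \<longrightarrow>
        (\<forall>x \<in> C k. d \<epsilon> (k - 1) i (d \<zeta> k j x) = d \<zeta> (k - 1) (j - 1) (d \<epsilon> k i x)))"

definition semi_strong_skew_cubical ::
    "(nat \<Rightarrow> 'c set) \<Rightarrow> (sign \<Rightarrow> nat \<Rightarrow> nat \<Rightarrow> 'c \<Rightarrow> 'c) \<Rightarrow> (nat \<Rightarrow> nat \<Rightarrow> 'c \<Rightarrow> 'c) \<Rightarrow> bool" where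
  "semi_strong_skew_cubical C d s \<longleftrightarrow>
     pre_cubical C d \<and>
     (\<forall>k i. 1 \<le> i \<and> i \<le> k \<longrightarrow> s k i \<in> C k \<rightarrow> C (k + 1)) \<and>
     (\<forall>\<epsilon> k i j. 1 \<le> i \<and> i < j \<and> j \<le> k \<longrightarrow>
        (\<forall>x \<in> C k. d \<epsilon> (k + 1) i (s k j x) = s (k - 1) (j - 1) (d \<epsilon> k i x))) \<and>
     (\<forall>\<epsilon> k i j. 1 \<le> j \<and> j + 1 < i \<and> i \<le> k + 1 \<longrightarrow>
        (\<forall>x \<in> C k. d \<epsilon> (k + 1) i (s k j x) = s (k - 1) j (d \<epsilon> k (i - 1) x))) \<and>
     (\<forall>\<epsilon> k i. 1 \<le> i \<and> i \<le> k \<longrightarrow>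
        (\<forall>x \<in> C k. d \<epsilon> (k + 1) i (s k i x) = d \<epsilon> (k + 1) (i + 1) (s k i x))) \<and>
     (\<forall>k i j. 1 \<le> i \<and> i \<le> j \<and> j \<le> k \<longrightarrow>
        (\<forall>x \<in> C k. s (k + 1) i (s k j x) = s (k + 1) (j + 1) (s k i x))) \<and>
     (\<forall>k i. 1 \<le> i \<and> i \<le> k \<longrightarrow>
        (\<forall>x \<in> C k. d Pos (k + 1) i (s k i x) = x \<and> d Pos (k + 1) (i + 1) (s k i x) = x))"

definition face :: "'x set \<Rightarrow> ('x \<times> 'x \<Rightarrow> 'x \<times> 'x) \<Rightarrow> ('m \<Rightarrow> 'x \<Rightarrow> 'm) \<Rightarrow> ('x \<Rightarrow> 'n \<Rightarrow> 'n)
    \<Rightarrow> sign \<Rightarrow> nat \<Rightarrow> nat \<Rightarrow> 'm \<times> 'x list \<times> 'n \<Rightarrow> 'm \<times> 'x list \<times> 'n" where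
  "face X \<sigma> ra la \<epsilon> k i = (case \<epsilon> of Pos \<Rightarrow> bd' X \<sigma> ra i | Neg \<Rightarrow> bd X \<sigma> la i)"


section \<open>Chains with coefficients in an abelian group\<close>

definition formal :: "'c set \<Rightarrow> ('c \<Rightarrow>\<^sub>0 'a::ab_group_add) set" where
  "formal S = {u. Poly_Mapping.keys u \<subseteq> S}"

definition linearize :: "('c \<Rightarrow> 'e) \<Rightarrow> ('c \<Rightarrow>\<^sub>0 'a::ab_group_add) \<Rightarrow> ('e \<Rightarrow>\<^sub>0 'a)" where
  "linearize f u = (\<Sum>c \<in> Poly_Mapping.keys u. Poly_Mapping.single (f c) (Poly_Mapping.lookup u c))"

definition zsmult :: "int \<Rightarrow> 'g::ab_group_add \<Rightarrow> 'g" where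
  "zsmult z u = (\<Sum>_<nat z. u) - (\<Sum>_<nat (- z). u)"

definition additive_subgroup :: "'g::ab_group_add set \<Rightarrow> bool" where
  "additive_subgroup H \<longleftrightarrow> 0 \<in> H \<and> (\<forall>u \<in> H. \<forall>v \<in> H. u + v \<in> H) \<and> (\<forall>u \<in> H. - u \<in> H)"

definition is_direct_sum :: "'g::ab_group_add set \<Rightarrow> 'g set \<Rightarrow> 'g set \<Rightarrow> bool" where
  "is_direct_sum G H K \<longleftrightarrow>
     additive_subgroup G \<and> additive_subgroup H \<and> additive_subgroup K \<and> H \<subseteq> G \<and> K \<subseteq> G \<and>
     (\<forall>g \<in> G. \<exists>!p. p \<in> H \<times> K \<and> g = fst p + snd p)"

definition degenerate_chains ::
    "(nat \<Rightarrow> 'c set) \<Rightarrow> (nat \<Rightarrow> nat \<Rightarrow> 'c \<Rightarrow> 'c) \<Rightarrow> nat \<Rightarrow> ('c \<Rightarrow>\<^sub>0 'a::ab_group_add) set" where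
  "degenerate_chains C s k =
     {\<Sum>i = 1..k - 1. u i | u. \<forall>i \<in> {1..k - 1}. u i \<in> formal (s (k - 1) i ` C (k - 1))}"

text \<open>The rightmost factor of \<open>(Id - s\<^sub>1 d\<^sup>+\<^sub>2) \<cdots> (Id - s\<^bsub>k-1\<^esub> d\<^sup>+\<^sub>k)\<close> is applied first; the product is
  \<open>Id\<close> for \<open>k \<le> 1\<close>.\<close>

definition eta :: "(sign \<Rightarrow> nat \<Rightarrow> nat \<Rightarrow> 'c \<Rightarrow> 'c) \<Rightarrow> (nat \<Rightarrow> nat \<Rightarrow> 'c \<Rightarrow> 'c) \<Rightarrow> nat
    \<Rightarrow> ('c \<Rightarrow>\<^sub>0 'a::ab_group_add) \<Rightarrow> ('c \<Rightarrow>\<^sub>0 'a)" where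
  "eta d s k u = foldr (\<lambda>i v. v - linearize (s (k - 1) i \<circ> d Pos k (i + 1)) v) [1..<k] u"

definition normalized_chains :: "(nat \<Rightarrow> 'c set) \<Rightarrow> (sign \<Rightarrow> nat \<Rightarrow> nat \<Rightarrow> 'c \<Rightarrow> 'c)
    \<Rightarrow> (nat \<Rightarrow> nat \<Rightarrow> 'c \<Rightarrow> 'c) \<Rightarrow> nat \<Rightarrow> ('c \<Rightarrow>\<^sub>0 'a::ab_group_add) set" where
  "normalized_chains C d s k = eta d s k ` formal (C k)"

definition differential :: "(sign \<Rightarrow> nat \<Rightarrow> nat \<Rightarrow> 'c \<Rightarrow> 'c) \<Rightarrow> int \<Rightarrow> int \<Rightarrow> nat
    \<Rightarrow> ('c \<Rightarrow>\<^sub>0 'a::ab_group_add) \<Rightarrow> ('c \<Rightarrow>\<^sub>0 'a)" where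
  "differential d \<alpha> \<beta> k u =
     zsmult \<alpha> (\<Sum>i = 1..k. zsmult ((- 1) ^ (i - 1)) (linearize (d Pos k i) u)) +
     zsmult \<beta> (\<Sum>i = 1..k. zsmult ((- 1) ^ (i - 1)) (linearize (d Neg k i) u))"

end

theory Submission
  imports Defs "HOL.Modules"
begin

text \<open>View \<open>(y\<^sub>1, \<dots>, y\<^sub>k)\<close> as a \<open>k\<close>-cube with parallel edges carrying different labels: \<open>d\<^sub>i\<close> passes to a
  face, relabelling the remaining directions by \<open>\<sigma>\<close>, and \<open>\<chi>\<^sub>i\<close> is the label of the edge in direction \<open>i\<close> that is
  left when all other directions are contracted by the \<open>d\<^sub>j\<close>. The Yang-Baxter equation says that
  contractions commute, so \<open>\<chi>\<^sub>i\<close> is invariant under \<open>d\<^sub>j\<close> for \<open>j \<noteq> i\<close>. Every identity between actions of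
  the \<open>\<chi>\<^sub>i\<close> then reduces to tuples of length one or two, where it is the module axiom or
  \<open>a \<cdot> a = a \<cdot>\<^sup>~ a = t a\<close>; the identities involving degeneracies are those for boundaries, applied to
  tuples with repeated entries.

  The decomposition holds for all semi-strong skew cubical structures. The factor
  \<open>Id - s\<^sub>j d\<^sup>+\<^bsub>j+1\<^esub>\<close> kills \<open>Im s\<^sub>j\<close>, and the factors to the right of it preserve \<open>Im s\<^sub>j\<close>, so \<open>\<eta>\<close> is a
  projection with kernel the degenerate chains. Dually, \<open>d\<^sup>+\<^bsub>j+1\<^esub>\<close> commutes past the factors to the
  left and kills this one, so the image of \<open>\<eta>\<close> is the common kernel of \<open>d\<^sup>+\<^sub>2, \<dots>, d\<^sup>+\<^sub>k\<close>, which all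
  boundaries preserve by the pre-cubical identities.\<close>


section \<open>Formal linear combinations\<close>

lemma linearize_superset:
  assumes "finite S" "Poly_Mapping.keys u \<subseteq> S"
  shows "linearize f u = (\<Sum>c\<in>S. Poly_Mapping.single (f c) (Poly_Mapping.lookup u c))"
  unfolding linearize_def using assms
  by (intro sum.mono_neutral_left) (auto simp: in_keys_iff)

text \<open>Coefficients may cancel in \<open>u + v\<close>, so the three sums are first written
  over one finite set containing the keys of both.\<close>

lemma additive_linearize: "additive (linearize f :: ('c \<Rightarrow>\<^sub>0 'a::ab_group_add) \<Rightarrow> _)"
proof
  fix u v :: "'c \<Rightarrow>\<^sub>0 'a"
  let ?S = "Poly_Mapping.keys u \<union> Poly_Mapping.keys v"
  have "finite ?S" "Poly_Mapping.keys (u + v) \<subseteq> ?S"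
    using Poly_Mapping.keys_add[of u v] by auto
  then show "linearize f (u + v) = linearize f u + linearize f v"
    by (simp add: linearize_superset[of ?S] lookup_add single_add sum.distrib)
qed

lemmas linearize_add = additive.add[OF additive_linearize]
  and linearize_sum = additive.sum[OF additive_linearize]

lemma linearize_single: "linearize f (Poly_Mapping.single c a) = Poly_Mapping.single (f c) a"
  by (simp add: linearize_def)

lemma linearize_cong:
  assumes "u \<in> formal S" "\<And>c. c \<in> S \<Longrightarrow> f c = g c"
  shows "linearize f u = linearize g u"
  unfolding linearize_def using assms by (intro sum.cong) (auto simp: formal_def subset_iff)

lemma linearize_comp: "linearize f (linearize g u) = linearize (f \<circ> g) u"
  \<comment> \<open>Only the inner combination is expanded: \<open>g\<close> may merge cells, so the
    keys of \<open>linearize g u\<close> need not be the image of those of \<open>u\<close>.\<close>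
  by (subst (2) linearize_def) (simp add: linearize_sum linearize_single, simp add: linearize_def)

lemma linearize_id_on:
  assumes "u \<in> formal S" "\<And>c. c \<in> S \<Longrightarrow> f c = c"
  shows "linearize f u = u"
proof (rule poly_mapping_eqI)
  fix x
  have "linearize f u = (\<Sum>c\<in>Poly_Mapping.keys u. Poly_Mapping.single c (Poly_Mapping.lookup u c))"
    unfolding linearize_def using assms by (intro sum.cong) (auto simp: formal_def subset_iff)
  then show "Poly_Mapping.lookup (linearize f u) x = Poly_Mapping.lookup u x"
    by (auto simp: lookup_sum lookup_single when_def sum.delta in_keys_iff)
qed

lemma formal_mono: "S \<subseteq> T \<Longrightarrow> formal S \<subseteq> formal T"
  by (auto simp: formal_def)

section \<open>Subgroups and integer multiples\<close>

lemma subgroup_formal: "additive_subgroup (formal S)"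
  using Poly_Mapping.keys_add by (fastforce simp: additive_subgroup_def formal_def)

lemma subgroup_zero: "additive_subgroup H \<Longrightarrow> 0 \<in> H"
  by (simp add: additive_subgroup_def)

lemma subgroup_add: "additive_subgroup H \<Longrightarrow> u \<in> H \<Longrightarrow> v \<in> H \<Longrightarrow> u + v \<in> H"
  by (simp add: additive_subgroup_def)

lemma subgroup_uminus: "additive_subgroup H \<Longrightarrow> u \<in> H \<Longrightarrow> - u \<in> H"
  by (simp add: additive_subgroup_def)

lemma subgroup_diff:
  assumes "additive_subgroup H" "u \<in> H" "v \<in> H"
  shows "u - v \<in> H"
  using subgroup_add[OF assms(1,2) subgroup_uminus[OF assms(1,3)]] by simp

lemma subgroup_sum:
  assumes "additive_subgroup H" "\<And>i. i \<in> I \<Longrightarrow> f i \<in> H"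
  shows "sum f I \<in> H"
  using assms(2)
  by (induction I rule: infinite_finite_induct)
    (simp_all add: subgroup_zero[OF assms(1)] subgroup_add[OF assms(1)])

lemma subgroup_zsmult: "additive_subgroup H \<Longrightarrow> u \<in> H \<Longrightarrow> zsmult z u \<in> H"
  unfolding zsmult_def by (intro subgroup_diff subgroup_sum)

lemma subgroup_range_additive:
  assumes "additive f" "additive_subgroup H"
  shows "additive_subgroup (f ` H)"
  using assms(2) additive.add[OF assms(1), symmetric] additive.zero[OF assms(1), symmetric]
    additive.minus[OF assms(1), symmetric]
  unfolding additive_subgroup_def by auto

lemma zsmult_0 [simp]: "zsmult z 0 = 0"
  by (simp add: zsmult_def)

lemma zsmult_add: "zsmult z (u + v) = zsmult z u + zsmult z v"
  by (simp add: zsmult_def sum.distrib)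

lemma zsmult_uminus: "zsmult (- z) u = - zsmult z u"
  by (simp add: zsmult_def)

lemma additive_zsmult: "additive f \<Longrightarrow> f (zsmult z u) = zsmult z (f u)"
  by (simp add: zsmult_def additive.diff additive.sum)

lemma formal_image: "formal (f ` S) = linearize f ` formal S"
proof (intro equalityI subsetI)
  fix u assume u: "u \<in> formal (f ` S)"
  let ?v = "linearize (inv_into S f) u"
  have "u = linearize f ?v"
    using u unfolding linearize_comp
    by (intro linearize_id_on[symmetric, of _ "f ` S"]) (auto simp: f_inv_into_f)
  moreover have "?v \<in> formal S"
    unfolding linearize_def using u
    by (intro subgroup_sum subgroup_formal) (auto simp: formal_def inv_into_into subset_iff)
  ultimately show "u \<in> linearize f ` formal S" by blast
next
  fix u assume "u \<in> linearize f ` formal S"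
  then obtain v where "v \<in> formal S" "u = linearize f v" by blast
  then show "u \<in> formal (f ` S)"
    unfolding linearize_def
    by (auto intro!: subgroup_sum subgroup_formal) (auto simp: formal_def)
qed

lemma linearize_formal: "f \<in> S \<rightarrow> T \<Longrightarrow> u \<in> formal S \<Longrightarrow> linearize f u \<in> formal T"
  using formal_image[of f S] formal_mono[of "f ` S" T] by (auto simp: Pi_iff image_subset_iff)


section \<open>Normalization of semi-strong skew cubical structures\<close>

lemma subgroup_degenerate_chains: "additive_subgroup (degenerate_chains C s k)"
  unfolding additive_subgroup_def
proof (intro conjI ballI)
  show "0 \<in> degenerate_chains C s k"
    unfolding degenerate_chains_def
    by (auto intro!: exI[of _ "\<lambda>_. 0"] simp: subgroup_zero[OF subgroup_formal])
next
  fix u v :: "'a \<Rightarrow>\<^sub>0 'b"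
  assume "u \<in> degenerate_chains C s k" "v \<in> degenerate_chains C s k"
  then obtain f g where
    "u = (\<Sum>i = 1..k - 1. f i)" "\<forall>i \<in> {1..k - 1}. f i \<in> formal (s (k - 1) i ` C (k - 1))"
    "v = (\<Sum>i = 1..k - 1. g i)" "\<forall>i \<in> {1..k - 1}. g i \<in> formal (s (k - 1) i ` C (k - 1))"
    unfolding degenerate_chains_def by blast
  then show "u + v \<in> degenerate_chains C s k"
    unfolding degenerate_chains_def
    by (auto intro!: exI[of _ "\<lambda>i. f i + g i"] subgroup_add[OF subgroup_formal] simp: sum.distrib)
next
  fix u :: "'a \<Rightarrow>\<^sub>0 'b"
  assume "u \<in> degenerate_chains C s k"
  then obtain f where
    "u = (\<Sum>i = 1..k - 1. f i)" "\<forall>i \<in> {1..k - 1}. f i \<in> formal (s (k - 1) i ` C (k - 1))"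
    unfolding degenerate_chains_def by blast
  then show "- u \<in> degenerate_chains C s k"
    unfolding degenerate_chains_def
    by (auto intro!: exI[of _ "\<lambda>i. - f i"] subgroup_uminus[OF subgroup_formal] simp: sum_negf)
qed

lemma degenerate_chainsI:
  assumes "i \<in> {1..k - 1}" "u \<in> formal (s (k - 1) i ` C (k - 1))"
  shows "u \<in> degenerate_chains C s k"
proof -
  let ?u = "\<lambda>j. if j = i then u else 0"
  have "u = (\<Sum>j = 1..k - 1. ?u j)"
    using assms(1) by simp
  moreover have "\<forall>j\<in>{1..k - 1}. ?u j \<in> formal (s (k - 1) j ` C (k - 1))"
    using assms(2) subgroup_zero[OF subgroup_formal] by auto
  ultimately show ?thesis
    unfolding degenerate_chains_def by blast
qed

text \<open>Reduces a claim about all degenerate chains to generators. It serves with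
  \<open>H\<close> zero for the vanishing of \<open>eta\<close>, with all chains for the inclusion,
  and with degenerate chains for the differential.\<close>

lemma degenerate_chains_image:
  assumes "additive f" "additive_subgroup H" "u \<in> degenerate_chains C s k"
    and "\<And>i w. i \<in> {1..k - 1} \<Longrightarrow> w \<in> formal (C (k - 1)) \<Longrightarrow> f (linearize (s (k - 1) i) w) \<in> H"
  shows "f u \<in> H"
proof -
  obtain v where "u = (\<Sum>i = 1..k - 1. v i)"
    "\<forall>i \<in> {1..k - 1}. v i \<in> linearize (s (k - 1) i) ` formal (C (k - 1))"
    using assms(3) unfolding degenerate_chains_def formal_image by blast
  then show ?thesis
    using assms(4) by (auto simp: additive.sum[OF assms(1)] intro!: subgroup_sum[OF assms(2)])
qed

lemma additive_differential: "additive (differential d \<alpha> \<beta> k)"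
  by unfold_locales (simp add: differential_def linearize_add zsmult_add sum.distrib)

section \<open>Linearized cubical identities\<close>

locale skew_cubical =
  fixes C :: "nat \<Rightarrow> 'c set" and d :: "sign \<Rightarrow> nat \<Rightarrow> nat \<Rightarrow> 'c \<Rightarrow> 'c"
    and s :: "nat \<Rightarrow> nat \<Rightarrow> 'c \<Rightarrow> 'c"
  assumes cubical: "semi_strong_skew_cubical C d s"
begin

lemma d_maps: "1 \<le> i \<Longrightarrow> i \<le> k \<Longrightarrow> d \<epsilon> k i \<in> C k \<rightarrow> C (k - 1)"
  using cubical by (simp add: semi_strong_skew_cubical_def pre_cubical_def)

lemma s_maps: "1 \<le> i \<Longrightarrow> i \<le> k \<Longrightarrow> s k i \<in> C k \<rightarrow> C (k + 1)"
  using cubical by (simp add: semi_strong_skew_cubical_def)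

text \<open>The cubical identities are given only on the sets \<open>C k\<close>; this is why their
  lifts to \<open>ld\<close> and \<open>ls\<close> are stated for chains in
  \<open>formal (C k)\<close>.\<close>

definition ld :: "sign \<Rightarrow> nat \<Rightarrow> nat \<Rightarrow> ('c \<Rightarrow>\<^sub>0 'a::ab_group_add) \<Rightarrow> ('c \<Rightarrow>\<^sub>0 'a)"
  where "ld \<epsilon> k i = linearize (d \<epsilon> k i)"

definition ls :: "nat \<Rightarrow> nat \<Rightarrow> ('c \<Rightarrow>\<^sub>0 'a::ab_group_add) \<Rightarrow> ('c \<Rightarrow>\<^sub>0 'a)"
  where "ls k i = linearize (s k i)"

lemma additive_ld: "additive (ld \<epsilon> k i)"
  unfolding ld_def by (rule additive_linearize)

lemma additive_ls: "additive (ls k i)"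
  unfolding ls_def by (rule additive_linearize)

lemma ld_formal: "1 \<le> i \<Longrightarrow> i \<le> k \<Longrightarrow> u \<in> formal (C k) \<Longrightarrow> ld \<epsilon> k i u \<in> formal (C (k - 1))"
  unfolding ld_def using d_maps by (rule linearize_formal)

lemma ls_formal: "1 \<le> i \<Longrightarrow> i \<le> k \<Longrightarrow> u \<in> formal (C k) \<Longrightarrow> ls k i u \<in> formal (C (k + 1))"
  unfolding ls_def using s_maps by (rule linearize_formal)

lemma ld_ld:
  assumes "1 \<le> i" "i < j" "j \<le> k" "u \<in> formal (C k)"
  shows "ld \<epsilon> (k - 1) i (ld \<zeta> k j u) = ld \<zeta> (k - 1) (j - 1) (ld \<epsilon> k i u)"
  unfolding ld_def linearize_comp using assms cubical
  by (intro linearize_cong[OF assms(4)]) (simp add: semi_strong_skew_cubical_def pre_cubical_def)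

lemma ld_ls_less:
  assumes "1 \<le> i" "i < j" "j \<le> k" "u \<in> formal (C k)"
  shows "ld \<epsilon> (k + 1) i (ls k j u) = ls (k - 1) (j - 1) (ld \<epsilon> k i u)"
  unfolding ld_def ls_def linearize_comp using assms cubical
  by (intro linearize_cong[OF assms(4)]) (simp add: semi_strong_skew_cubical_def)

lemma ld_ls_greater:
  assumes "1 \<le> j" "j + 1 < i" "i \<le> k + 1" "u \<in> formal (C k)"
  shows "ld \<epsilon> (k + 1) i (ls k j u) = ls (k - 1) j (ld \<epsilon> k (i - 1) u)"
  unfolding ld_def ls_def linearize_comp using assms cubical
  by (intro linearize_cong[OF assms(4)]) (simp add: semi_strong_skew_cubical_def)

lemma ld_ls_middle:
  assumes "1 \<le> i" "i \<le> k" "u \<in> formal (C k)"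
  shows "ld \<epsilon> (k + 1) i (ls k i u) = ld \<epsilon> (k + 1) (i + 1) (ls k i u)"
  unfolding ld_def ls_def linearize_comp using assms cubical
  by (intro linearize_cong[OF assms(3)]) (simp add: semi_strong_skew_cubical_def)

lemma ls_ls:
  assumes "1 \<le> i" "i \<le> j" "j \<le> k" "u \<in> formal (C k)"
  shows "ls (k + 1) i (ls k j u) = ls (k + 1) (j + 1) (ls k i u)"
  unfolding ls_def linearize_comp using assms cubical
  by (intro linearize_cong[OF assms(4)]) (simp add: semi_strong_skew_cubical_def)

lemma ld_Pos_ls:
  assumes "1 \<le> i" "i \<le> k" "u \<in> formal (C k)"
  shows "ld Pos (k + 1) (i + 1) (ls k i u) = u"
  unfolding ld_def ls_def linearize_comp using assms cubical
  by (intro linearize_id_on[OF assms(3)]) (simp add: semi_strong_skew_cubical_def)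

section \<open>The projection \<eta> and the direct sum\<close>

definition eta_factor :: "nat \<Rightarrow> nat \<Rightarrow> ('c \<Rightarrow>\<^sub>0 'a::ab_group_add) \<Rightarrow> ('c \<Rightarrow>\<^sub>0 'a)"
  where "eta_factor k i v = v - ls (k - 1) i (ld Pos k (i + 1) v)"

lemma eta_eq: "eta d s k u = foldr (eta_factor k) [1..<k] u"
  unfolding eta_def eta_factor_def ld_def ls_def linearize_comp ..

lemma additive_eta_factor: "additive (eta_factor k i)"
  by unfold_locales
    (simp add: eta_factor_def additive.add[OF additive_ld] additive.add[OF additive_ls])

lemma additive_foldr_eta_factor: "additive (foldr (eta_factor k) is)"
  by (induction "is")
    (auto simp: additive_def additive.add[OF additive_eta_factor])

lemma additive_eta: "additive (eta d s k)"
  using additive_foldr_eta_factor[of k "[1..<k]"] by (simp add: additive_def eta_eq)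

lemma eta_factor_formal:
  assumes "1 \<le> i" "i < k" "v \<in> formal (C k)"
  shows "eta_factor k i v \<in> formal (C k)"
proof -
  \<comment> \<open>\<open>ls_formal\<close> produces degree \<open>k - 1 + 1\<close>, which is
    \<open>k\<close> because \<open>i < k\<close> excludes \<open>k = 0\<close>.\<close>
  have "ls (k - 1) i (ld Pos k (i + 1) v) \<in> formal (C (k - 1 + 1))"
    using assms by (intro ls_formal ld_formal) auto
  then show ?thesis
    using assms unfolding eta_factor_def by (intro subgroup_diff subgroup_formal) auto
qed

lemma foldr_eta_factor_formal:
  assumes "set is \<subseteq> {1..<k}" "u \<in> formal (C k)"
  shows "foldr (eta_factor k) is u \<in> formal (C k)"
  using assms by (induction "is") (auto intro!: eta_factor_formal)

lemma eta_formal: "u \<in> formal (C k) \<Longrightarrow> eta d s k u \<in> formal (C k)"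
  unfolding eta_eq by (rule foldr_eta_factor_formal) auto

text \<open>For i > j one has s_i d^+_{i+1} s_j = s_i s_j d^+_i = s_j s_{i-1} d^+_i, so the i-th
  factor sends s_j w' to s_j (w' - s_{i-1} d^+_i w').\<close>

lemma foldr_eta_factor_ls:
  assumes "1 \<le> j" "set is \<subseteq> {j<..<k}" "w \<in> formal (C (k - 1))"
  shows "\<exists>w' \<in> formal (C (k - 1)). foldr (eta_factor k) is (ls (k - 1) j w) = ls (k - 1) j w'"
  using assms(2)
proof (induction "is")
  case Nil
  then show ?case using assms(3) by auto
next
  case (Cons i "is")
  then obtain w' where w': "w' \<in> formal (C (k - 1))"
      "foldr (eta_factor k) is (ls (k - 1) j w) = ls (k - 1) j w'"
    by auto
  have ij: "j < i" "i < k" using Cons.prems by auto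
  \<comment> \<open>The degrees involved are k, k - 1 and k - 2; naming the lowest one avoids
    truncated subtraction.\<close>
  define n where "n = k - 2"
  then have n: "k = n + 2" using ij assms(1) by simp
  let ?w = "w' - ls n (i - 1) (ld Pos (n + 1) i w')"
  have l: "ld Pos (n + 1) i w' \<in> formal (C n)"
    using ld_formal[of i "n + 1" w' Pos] w'(1) ij assms(1) n by simp
  have "ld Pos (n + 2) (i + 1) (ls (n + 1) j w') = ls n j (ld Pos (n + 1) i w')"
    using ld_ls_greater[of j "i + 1" "n + 1" w' Pos] assms(1) ij n w'(1) by simp
  moreover have "ls (n + 1) j (ls n (i - 1) (ld Pos (n + 1) i w')) =
      ls (n + 1) i (ls n j (ld Pos (n + 1) i w'))"
    using ls_ls[of j "i - 1" n "ld Pos (n + 1) i w'"] assms(1) ij n l by simp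
  ultimately have "eta_factor k i (ls (k - 1) j w') = ls (k - 1) j ?w"
    unfolding eta_factor_def using n by (simp add: additive.diff[OF additive_ls])
  moreover have "?w \<in> formal (C (k - 1))"
  proof (intro subgroup_diff subgroup_formal w'(1))
    show "ls n (i - 1) (ld Pos (n + 1) i w') \<in> formal (C (k - 1))"
      using ls_formal[of "i - 1" n, OF _ _ l] assms(1) ij n by simp
  qed
  ultimately show ?case using w'(2) by auto
qed

text \<open>The factors to the right of the j-th act first and stay inside the image of s_j, where
  the j-th factor vanishes because d^+_{j+1} s_j = Id.\<close>

lemma eta_ls:
  assumes "1 \<le> j" "j < k" "w \<in> formal (C (k - 1))"
  shows "eta d s k (ls (k - 1) j w) = 0"
proof -
  have "[1..<k] = [1..<j] @ j # [Suc j..<k]"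
    using assms(1,2) upt_add_eq_append[of 1 j "k - j"] upt_conv_Cons[of j k] by simp
  moreover have "set [Suc j..<k] \<subseteq> {j<..<k}" by auto
  then obtain w' where w': "w' \<in> formal (C (k - 1))"
    "foldr (eta_factor k) [Suc j..<k] (ls (k - 1) j w) = ls (k - 1) j w'"
    using foldr_eta_factor_ls[OF assms(1) _ assms(3)] by blast
  moreover have "eta_factor k j (ls (k - 1) j w') = 0"
    unfolding eta_factor_def using ld_Pos_ls[of j "k - 1" w'] w'(1) assms(1,2) by simp
  ultimately show ?thesis
    by (simp add: eta_eq additive.zero[OF additive_foldr_eta_factor])
qed

lemma eta_degenerate:
  assumes "u \<in> degenerate_chains C s k"
  shows "eta d s k u = 0"
proof -
  have "eta d s k u \<in> {0}"
  proof (rule degenerate_chains_image[OF additive_eta _ assms])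
    fix i and w :: "'c \<Rightarrow>\<^sub>0 'a::ab_group_add"
    assume "i \<in> {1..k - 1}" "w \<in> formal (C (k - 1))"
    then show "eta d s k (linearize (s (k - 1) i) w) \<in> {0}"
      using eta_ls[of i k w] by (auto simp: ls_def)
  qed (simp add: additive_subgroup_def)
  then show ?thesis by simp
qed

lemma degenerate_subset_formal: "degenerate_chains C s k \<subseteq> formal (C k)"
proof
  fix u :: "'c \<Rightarrow>\<^sub>0 'a::ab_group_add"
  assume "u \<in> degenerate_chains C s k"
  moreover have "additive (\<lambda>u :: 'c \<Rightarrow>\<^sub>0 'a. u)" by unfold_locales simp
  moreover have "linearize (s (k - 1) i) w \<in> formal (C k)"
    if "i \<in> {1..k - 1}" "w \<in> formal (C (k - 1))" for i and w :: "'c \<Rightarrow>\<^sub>0 'a"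
    using ls_formal[of i "k - 1" w] that by (simp add: ls_def)
  ultimately show "u \<in> formal (C k)"
    using degenerate_chains_image[of "\<lambda>u. u" "formal (C k)" u C s k] subgroup_formal by blast
qed

lemma ls_degenerate:
  assumes "1 \<le> i" "i < k" "w \<in> formal (C (k - 1))"
  shows "ls (k - 1) i w \<in> degenerate_chains C s k"
  using assms by (intro degenerate_chainsI[of i]) (auto simp: formal_image ls_def)

text \<open>Each factor changes its argument by an element of the image of some s_i, and these
  changes add up.\<close>

lemma eta_minus_degenerate:
  assumes "u \<in> formal (C k)"
  shows "u - eta d s k u \<in> degenerate_chains C s k"
proof -
  have "u - foldr (eta_factor k) is u \<in> degenerate_chains C s k" if "set is \<subseteq> {1..<k}" for "is"
    using that
  proof (induction "is")
    case Nil
    then show ?case by (simp add: subgroup_zero[OF subgroup_degenerate_chains])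
  next
    case (Cons i "is")
    let ?v = "foldr (eta_factor k) is u"
    have "ls (k - 1) i (ld Pos k (i + 1) ?v) \<in> degenerate_chains C s k"
      using Cons.prems foldr_eta_factor_formal[OF _ assms, of "is"]
      by (intro ls_degenerate ld_formal) auto
    moreover have "u - foldr (eta_factor k) (i # is) u = (u - ?v) + ls (k - 1) i (ld Pos k (i + 1) ?v)"
      by (simp add: eta_factor_def)
    moreover have "u - ?v \<in> degenerate_chains C s k"
      using Cons by simp
    ultimately show ?case
      by (simp only: subgroup_add[OF subgroup_degenerate_chains])
  qed
  from this[of "[1..<k]"] show ?thesis by (simp add: eta_eq)
qed

lemma subgroup_normalized_chains: "additive_subgroup (normalized_chains C d s k)"
  unfolding normalized_chains_def
  by (rule subgroup_range_additive[OF additive_eta subgroup_formal])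

text \<open>Idempotence of \<open>eta\<close>: the difference \<open>u - eta d s k u\<close> is
  degenerate and hence killed by \<open>eta\<close>.\<close>

lemma eta_normalized:
  assumes "v \<in> normalized_chains C d s k"
  shows "eta d s k v = v"
proof -
  obtain u where u: "u \<in> formal (C k)" "v = eta d s k u"
    using assms unfolding normalized_chains_def by blast
  have "eta d s k (u - v) = 0"
    using eta_degenerate eta_minus_degenerate u by blast
  then show ?thesis using u(2) by (simp add: additive.diff[OF additive_eta])
qed

lemma direct_sum:
  "is_direct_sum (formal (C k)) (degenerate_chains C s k) (normalized_chains C d s k)"
  unfolding is_direct_sum_def
proof (intro conjI ballI subgroup_formal subgroup_degenerate_chains subgroup_normalized_chains
    degenerate_subset_formal)
  show "normalized_chains C d s k \<subseteq> formal (C k)"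
    unfolding normalized_chains_def using eta_formal by blast
next
  fix u :: "'c \<Rightarrow>\<^sub>0 'a::ab_group_add"
  assume u: "u \<in> formal (C k)"
  show "\<exists>!p. p \<in> degenerate_chains C s k \<times> normalized_chains C d s k \<and> u = fst p + snd p"
  proof (rule ex1I[of _ "(u - eta d s k u, eta d s k u)"])
    show "(u - eta d s k u, eta d s k u) \<in> degenerate_chains C s k \<times> normalized_chains C d s k \<and>
        u = fst (u - eta d s k u, eta d s k u) + snd (u - eta d s k u, eta d s k u)"
      using u eta_minus_degenerate by (auto simp: normalized_chains_def)
  next
    fix p assume "p \<in> degenerate_chains C s k \<times> normalized_chains C d s k \<and> u = fst p + snd p"
    then obtain v w where p: "p = (v, w)" "v \<in> degenerate_chains C s k"
        "w \<in> normalized_chains C d s k" "u = v + w"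
      by auto
    \<comment> \<open>Uniqueness: \<open>eta\<close> kills the degenerate summand and fixes the
      normalized one.\<close>
    then have "eta d s k u = w"
      by (simp add: additive.add[OF additive_eta] eta_degenerate eta_normalized)
    then show "p = (u - eta d s k u, eta d s k u)" using p by auto
  qed
qed

section \<open>Stability of both summands under the differentials\<close>

lemma differential_eq:
  "differential d \<alpha> \<beta> k u =
     zsmult \<alpha> (\<Sum>i = 1..k. zsmult ((- 1) ^ (i - 1)) (ld Pos k i u)) +
     zsmult \<beta> (\<Sum>i = 1..k. zsmult ((- 1) ^ (i - 1)) (ld Neg k i u))"
  by (simp add: differential_def ld_def)

text \<open>The terms i = j and i = j + 1 cancel; the others lie in the images of s_{j-1} and s_j.
  Each sign is treated separately, which allows arbitrary \<alpha> and \<beta>.\<close>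

lemma alternating_sum_ls:
  assumes j: "1 \<le> j" "j < k" and w: "w \<in> formal (C (k - 1))"
  shows "(\<Sum>i = 1..k. zsmult ((- 1) ^ (i - 1)) (ld \<epsilon> k i (ls (k - 1) j w)))
    \<in> degenerate_chains C s (k - 1)"
proof -
  define n where "n = k - 2"
  then have n: "k = n + 2" using j by simp
  let ?f = "\<lambda>i. zsmult ((- 1) ^ (i - 1)) (ld \<epsilon> k i (ls (k - 1) j w))"
  have "{1..k} = {1..<j} \<union> {j, j + 1} \<union> {j + 2..k}" using j by auto
  then have "sum ?f {1..k} = sum ?f ({1..<j} \<union> {j, j + 1} \<union> {j + 2..k})" by (rule arg_cong)
  also have "\<dots> = sum ?f ({1..<j} \<union> {j, j + 1}) + sum ?f {j + 2..k}"
    by (rule sum.union_disjoint) auto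
  also have "sum ?f ({1..<j} \<union> {j, j + 1}) = sum ?f {1..<j} + sum ?f {j, j + 1}"
    by (rule sum.union_disjoint) auto
  also have "sum ?f {j, j + 1} = ?f j + ?f (j + 1)"
    by simp
  also have "?f j + ?f (j + 1) = 0"
  proof -
    have "ld \<epsilon> k j (ls (k - 1) j w) = ld \<epsilon> k (j + 1) (ls (k - 1) j w)"
      using ld_ls_middle[of j "n + 1" w \<epsilon>] j w n by simp
    moreover have "(- 1 :: int) ^ (j + 1 - 1) = - ((- 1) ^ (j - 1))"
      using j(1) by (cases j) auto
    ultimately show ?thesis by (simp add: zsmult_uminus)
  qed
  finally have split: "sum ?f {1..k} = sum ?f {1..<j} + sum ?f {j + 2..k}" by simp
  have "ld \<epsilon> k i (ls (k - 1) j w) \<in> degenerate_chains C s (k - 1)" if "i \<in> {1..<j}" for i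
  proof -
    have "ld \<epsilon> k i (ls (k - 1) j w) = ls n (j - 1) (ld \<epsilon> (n + 1) i w)"
      using ld_ls_less[of i j "n + 1" w \<epsilon>] that j w n by simp
    moreover have "ld \<epsilon> (n + 1) i w \<in> formal (C n)"
      using ld_formal[of i "n + 1" w \<epsilon>] that j w n by simp
    \<comment> \<open>The range of i is nonempty only if j > 1, so s_{j-1} is a genuine
      degeneracy.\<close>
    moreover have "1 \<le> j - 1" using that by auto
    ultimately show ?thesis
      using ls_degenerate[of "j - 1" "n + 1" "ld \<epsilon> (n + 1) i w"] j n by simp
  qed
  moreover have "ld \<epsilon> k i (ls (k - 1) j w) \<in> degenerate_chains C s (k - 1)"
    if "i \<in> {j + 2..k}" for i
  proof -
    have "ld \<epsilon> k i (ls (k - 1) j w) = ls n j (ld \<epsilon> (n + 1) (i - 1) w)"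
      using ld_ls_greater[of j i "n + 1" w \<epsilon>] that j w n by simp
    moreover have "1 \<le> i - 1" "i - 1 \<le> n + 1" using that j n by auto
    then have "ld \<epsilon> (n + 1) (i - 1) w \<in> formal (C n)"
      using ld_formal[of "i - 1" "n + 1" w \<epsilon>] that j w n by simp
    ultimately show ?thesis
      using ls_degenerate[of j "n + 1" "ld \<epsilon> (n + 1) (i - 1) w"] that j n by simp
  qed
  ultimately show ?thesis
    unfolding split
    by (intro subgroup_add subgroup_sum subgroup_zsmult subgroup_degenerate_chains)
qed

lemma differential_degenerate:
  assumes "u \<in> degenerate_chains C s k"
  shows "differential d \<alpha> \<beta> k u \<in> degenerate_chains C s (k - 1)"
proof (rule degenerate_chains_image[OF additive_differential subgroup_degenerate_chains assms])
  fix i and w :: "'c \<Rightarrow>\<^sub>0 'a::ab_group_add"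
  assume "i \<in> {1..k - 1}" "w \<in> formal (C (k - 1))"
  then show "differential d \<alpha> \<beta> k (linearize (s (k - 1) i) w) \<in> degenerate_chains C s (k - 1)"
    unfolding differential_eq ls_def[symmetric]
    by (intro subgroup_add subgroup_zsmult subgroup_degenerate_chains alternating_sum_ls) auto
qed

text \<open>For i = j, d^+_{j+1} s_j = Id makes the two terms cancel. For i < j, d^+_{j+1} s_i
  d^+_{i+1} = s_i d^+_j d^+_{i+1} = s_i d^+_{i+1} d^+_{j+1}, which kills v.\<close>

lemma ld_Pos_eta_factor:
  assumes "1 \<le> i" "i \<le> j" "j < k" "v \<in> formal (C k)" "i = j \<or> ld Pos k (j + 1) v = 0"
  shows "ld Pos k (j + 1) (eta_factor k i v) = 0"
proof (cases "i = j")
  case True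
  have "ld Pos k (j + 1) v \<in> formal (C (k - 1))"
    using assms by (intro ld_formal) auto
  then show ?thesis
    using True ld_Pos_ls[of j "k - 1" "ld Pos k (j + 1) v"] assms
    by (simp add: eta_factor_def additive.diff[OF additive_ld])
next
  case False
  define n where "n = k - 2"
  then have n: "k = n + 2" using False assms by simp
  have "ld Pos k (i + 1) v \<in> formal (C (n + 1))"
    using ld_formal[of "i + 1" k v Pos] assms n by simp
  then have "ld Pos k (j + 1) (ls (k - 1) i (ld Pos k (i + 1) v)) =
      ls n i (ld Pos (n + 1) j (ld Pos k (i + 1) v))"
    using ld_ls_greater[of i "j + 1" "n + 1" "ld Pos k (i + 1) v" Pos] assms n False by simp
  also have "ld Pos (n + 1) j (ld Pos k (i + 1) v) = ld Pos (n + 1) (i + 1) (ld Pos k (j + 1) v)"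
    using ld_ld[of "i + 1" "j + 1" k v Pos Pos] assms n False by simp
  also have "\<dots> = 0"
    using assms(5) False by (simp add: additive.zero[OF additive_ld])
  finally show ?thesis
    using assms(5) False
    by (simp add: eta_factor_def additive.diff[OF additive_ld] additive.zero[OF additive_ls])
qed

text \<open>The j-th factor creates the vanishing of d^+_{j+1}; the factors to its left, applied
  later, preserve it.\<close>

lemma ld_Pos_eta:
  assumes "1 \<le> j" "j < k" "u \<in> formal (C k)"
  shows "ld Pos k (j + 1) (eta d s k u) = 0"
proof -
  have "[1..<k] = [1..<j] @ j # [Suc j..<k]"
    using assms(1,2) upt_add_eq_append[of 1 j "k - j"] upt_conv_Cons[of j k] by simp
  moreover define v where "v = eta_factor k j (foldr (eta_factor k) [Suc j..<k] u)"
  ultimately have eta: "eta d s k u = foldr (eta_factor k) [1..<j] v"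
    by (simp add: eta_eq)
  have w: "foldr (eta_factor k) [Suc j..<k] u \<in> formal (C k)"
    using assms by (intro foldr_eta_factor_formal) auto
  then have v: "v \<in> formal (C k)" "ld Pos k (j + 1) v = 0"
    unfolding v_def using assms by (simp_all add: eta_factor_formal ld_Pos_eta_factor[of j j k, simplified])
  have "ld Pos k (j + 1) (foldr (eta_factor k) is v) = 0" if "set is \<subseteq> {1..<j}" for "is"
    using that
  proof (induction "is")
    case Nil
    then show ?case using v(2) by simp
  next
    case (Cons i "is")
    moreover have "set is \<subseteq> {1..<k}" using Cons.prems assms(2) by auto
    ultimately show ?case
      using assms foldr_eta_factor_formal[OF _ v(1), of "is"]
        ld_Pos_eta_factor[of i j k "foldr (eta_factor k) is v"]
      by auto
  qed
  then show ?thesis unfolding eta by auto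
qed

text \<open>Conversely to \<open>ld_Pos_eta\<close>, a chain killed by d^+_2, ..., d^+_k is fixed by
  every factor of \<open>eta\<close>. In this kernel form, stability under boundaries no longer
  involves degeneracies.\<close>

lemma normalized_chains_eq:
  "normalized_chains C d s k = {u \<in> formal (C k). \<forall>j\<in>{1..<k}. ld Pos k (j + 1) u = 0}"
proof (intro equalityI subsetI)
  fix u assume "u \<in> normalized_chains C d s k"
  then show "u \<in> {u \<in> formal (C k). \<forall>j\<in>{1..<k}. ld Pos k (j + 1) u = 0}"
    unfolding normalized_chains_def using eta_formal ld_Pos_eta by auto
next
  fix u assume u: "u \<in> {u \<in> formal (C k). \<forall>j\<in>{1..<k}. ld Pos k (j + 1) u = 0}"
  have "foldr (eta_factor k) is u = u" if "set is \<subseteq> {1..<k}" for "is"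
    using that u
    by (induction "is") (auto simp: eta_factor_def additive.zero[OF additive_ls])
  from this[of "[1..<k]"] have "eta d s k u = u"
    by (simp add: eta_eq)
  then show "u \<in> normalized_chains C d s k"
    unfolding normalized_chains_def using u by (metis (no_types, lifting) image_eqI mem_Collect_eq)
qed

lemma differential_normalized:
  assumes u: "u \<in> normalized_chains C d s k"
  shows "differential d \<alpha> \<beta> k u \<in> normalized_chains C d s (k - 1)"
proof -
  have uC: "u \<in> formal (C k)" and u0: "\<And>j. 1 \<le> j \<Longrightarrow> j < k \<Longrightarrow> ld Pos k (j + 1) u = 0"
    using u unfolding normalized_chains_eq by auto
  have zero: "ld Pos (k - 1) (j + 1) (ld \<epsilon> k i u) = 0"
    if "1 \<le> i" "i \<le> k" "1 \<le> j" "j < k - 1" for \<epsilon> i j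
  \<comment> \<open>d^+_{j+1} moves past d_i as d^+_{j+2} or as d^+_{j+1}; either index is at least
    2, so the result kills u.\<close>
  proof (cases "i \<le> j + 1")
    case True
    then have "ld \<epsilon> (k - 1) i (ld Pos k (j + 2) u) = ld Pos (k - 1) (j + 1) (ld \<epsilon> k i u)"
      using ld_ld[of i "j + 2" k u \<epsilon> Pos] that uC by simp
    then show ?thesis
      using u0[of "j + 1"] that by (simp add: additive.zero[OF additive_ld])
  next
    case False
    then have "ld Pos (k - 1) (j + 1) (ld \<epsilon> k i u) = ld \<epsilon> (k - 1) (i - 1) (ld Pos k (j + 1) u)"
      using ld_ld[of "j + 1" i k u Pos \<epsilon>] that uC by simp
    then show ?thesis
      using u0[of j] that by (simp add: additive.zero[OF additive_ld])
  qed
  have "ld Pos (k - 1) (j + 1) (differential d \<alpha> \<beta> k u) = 0" if "1 \<le> j" "j < k - 1" for j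
    using zero that
    by (simp add: differential_eq additive.add[OF additive_ld] additive.sum[OF additive_ld]
        additive_zsmult[OF additive_ld])
  moreover have "differential d \<alpha> \<beta> k u \<in> formal (C (k - 1))"
    unfolding differential_eq using uC
    by (intro subgroup_add subgroup_zsmult subgroup_sum subgroup_formal ld_formal) auto
  ultimately show ?thesis unfolding normalized_chains_eq by auto
qed

end


section \<open>Removing and repeating entries of a list\<close>

text \<open>Positions start at 0, so \<open>remove i\<close> and \<open>dup i\<close> describe what
  the boundary d'_{i+1} and the degeneracy s_{i+1} do to the tuple.\<close>

definition remove :: "nat \<Rightarrow> 'a list \<Rightarrow> 'a list"
  where "remove i xs = take i xs @ drop (Suc i) xs"

definition dup :: "nat \<Rightarrow> 'a list \<Rightarrow> 'a list"
  where "dup i xs = take (Suc i) xs @ drop i xs"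

text \<open>For i different from j, the new position of the entry at i once position j has been
  deleted or contracted.\<close>

definition shift :: "nat \<Rightarrow> nat \<Rightarrow> nat"
  where "shift j i = (if j < i then i - 1 else i)"

lemma length_remove [simp]: "i < length xs \<Longrightarrow> length (remove i xs) = length xs - 1"
  by (simp add: remove_def)

lemma length_dup [simp]: "i < length xs \<Longrightarrow> length (dup i xs) = Suc (length xs)"
  by (simp add: dup_def)

lemma nth_remove:
  "i < length xs \<Longrightarrow> l < length xs - 1 \<Longrightarrow> remove i xs ! l = (if l < i then xs ! l else xs ! Suc l)"
  by (auto simp: remove_def nth_append)

lemma nth_dup:
  assumes "i < length xs" "l < Suc (length xs)"
  shows "dup i xs ! l = (if l \<le> i then xs ! l else xs ! (l - 1))"
proof (cases "l \<le> i")
  case False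
  then have "i + (l - Suc i) = l - 1" by simp
  then show ?thesis using False assms by (simp add: dup_def nth_append)
qed (use assms in \<open>simp add: dup_def nth_append\<close>)

lemma set_remove: "set (remove i xs) \<subseteq> set xs"
  by (auto simp: remove_def dest: in_set_takeD in_set_dropD)

lemma set_dup: "set (dup i xs) \<subseteq> set xs"
  by (auto simp: dup_def dest: in_set_takeD in_set_dropD)

lemma remove_remove:
  "i < j \<Longrightarrow> j < length xs \<Longrightarrow> remove i (remove j xs) = remove (j - 1) (remove i xs)"
  by (rule nth_equalityI) (auto simp: nth_remove)

lemma remove_dup_less:
  "i < j \<Longrightarrow> j < length xs \<Longrightarrow> remove i (dup j xs) = dup (j - 1) (remove i xs)"
  by (rule nth_equalityI) (auto simp: nth_remove nth_dup)

lemma remove_dup_greater: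
  "j < i \<Longrightarrow> i < length xs \<Longrightarrow> remove (Suc i) (dup j xs) = dup j (remove i xs)"
  by (rule nth_equalityI) (auto simp: nth_remove nth_dup)

lemma remove_dup_same:
  assumes "i < length xs"
  shows "remove i (dup i xs) = xs" "remove (Suc i) (dup i xs) = xs"
  by (rule nth_equalityI; use assms in \<open>auto simp: nth_remove nth_dup\<close>)+

lemma dup_dup:
  "i \<le> j \<Longrightarrow> j < length xs \<Longrightarrow> dup i (dup j xs) = dup (Suc j) (dup i xs)"
  by (rule nth_equalityI) (auto simp: nth_dup)


section \<open>Left non-degenerate braided sets\<close>

locale nondegenerate_braiding =
  fixes X :: "'x set" and \<sigma> :: "'x \<times> 'x \<Rightarrow> 'x \<times> 'x"
  assumes braided: "braided_set X \<sigma>" and nondegenerate: "left_nondegenerate X \<sigma>"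
begin

abbreviation "L \<equiv> lpart \<sigma>"
abbreviation "R \<equiv> rpart \<sigma>"
abbreviation "td \<equiv> tdot X \<sigma>"
abbreviation "dt \<equiv> dot X \<sigma>"

lemma L_closed [simp, intro]: "a \<in> X \<Longrightarrow> b \<in> X \<Longrightarrow> L a b \<in> X"
  and R_closed [simp, intro]: "a \<in> X \<Longrightarrow> b \<in> X \<Longrightarrow> R a b \<in> X"
  using braided by (auto simp: braided_set_def lpart_def rpart_def Pi_iff mem_Times_iff)

lemma yang_baxter:
  assumes "a \<in> X" "b \<in> X" "c \<in> X"
  shows "L (L a b) (L (R a b) c) = L a (L b c)"
    and "R (L a b) (L (R a b) c) = L (R a (L b c)) (R b c)"
    and "R (R a b) c = R (R a (L b c)) (R b c)"
proof -
  have \<sigma>: "\<sigma> (a, b) = (L a b, R a b)" for a b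
    by (simp add: lpart_def rpart_def)
  have "(sigma_times_id \<sigma> \<circ> id_times_sigma \<sigma> \<circ> sigma_times_id \<sigma>) (a, b, c) =
        (id_times_sigma \<sigma> \<circ> sigma_times_id \<sigma> \<circ> id_times_sigma \<sigma>) (a, b, c)"
    using braided assms by (simp add: braided_set_def)
  then show "L (L a b) (L (R a b) c) = L a (L b c)"
    and "R (L a b) (L (R a b) c) = L (R a (L b c)) (R b c)"
    and "R (R a b) c = R (R a (L b c)) (R b c)"
    by (simp_all add: sigma_times_id_def id_times_sigma_def \<sigma>)
qed

lemma bij_R: "b \<in> X \<Longrightarrow> bij_betw (\<lambda>a. R a b) X X"
  using nondegenerate by (simp add: left_nondegenerate_def)

lemma td_closed [simp, intro]: "a \<in> X \<Longrightarrow> b \<in> X \<Longrightarrow> td b a \<in> X"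
  unfolding tdot_def by (rule bij_betw_apply[OF bij_betw_inv_into[OF bij_R]])

lemma R_td [simp]: "a \<in> X \<Longrightarrow> b \<in> X \<Longrightarrow> R (td b a) b = a"
  unfolding tdot_def by (rule bij_betw_inv_into_right[OF bij_R])

lemma td_R [simp]: "a \<in> X \<Longrightarrow> b \<in> X \<Longrightarrow> td b (R a b) = a"
  unfolding tdot_def by (rule bij_betw_inv_into_left[OF bij_R])

lemma dt_closed [simp, intro]: "a \<in> X \<Longrightarrow> b \<in> X \<Longrightarrow> dt a b \<in> X"
  by (simp add: dot_def)

lemma L_td [simp]: "L (td b a) b = dt a b"
  by (simp add: dot_def)

lemma image_td_closed [simp]: "b \<in> X \<Longrightarrow> A \<subseteq> X \<Longrightarrow> td b ` A \<subseteq> X"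
  and image_dt_closed [simp]: "b \<in> X \<Longrightarrow> A \<subseteq> X \<Longrightarrow> dt b ` A \<subseteq> X"
  using td_closed dt_closed by blast+

section \<open>Exchange laws from the Yang-Baxter equation\<close>

lemma td_td:
  assumes "a \<in> X" "b \<in> X" "c \<in> X"
  shows "td (td b a) (td b c) = td (dt a b) (td a c)"
proof -
  define x where "x = td (td b a) (td b c)"
  have x: "x \<in> X" "R x (td b a) = td b c" using assms by (simp_all add: x_def)
  \<comment> \<open>Acting on the right by \<open>td b a\<close> and then b equals acting by
    \<open>dt a b\<close> and then a; the claim inverts this identity.\<close>
  have "R (R x (dt a b)) a = c"
    using yang_baxter(3)[of x "td b a" b] x assms by simp
  then have "R x (dt a b) = td a c"
    using td_R[of "R x (dt a b)" a] x(1) assms by simp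
  then have "td (dt a b) (td a c) = x"
    using td_R[of x "dt a b"] x(1) assms by simp
  then show ?thesis by (simp add: x_def)
qed

lemma dt_td:
  assumes "a \<in> X" "b \<in> X" "c \<in> X"
  shows "dt (td b a) (td b c) = td (dt a b) (dt a c)"
proof -
  \<comment> \<open>The triple (w, r, b) is chosen so that \<open>R w r = p\<close>,
    \<open>R r b = c\<close> and \<open>R p b = a\<close>. The third Yang-Baxter component then
    determines \<open>R w (dt c b)\<close>, and the second yields the claim.\<close>
  define p r w where "p = td b a" and "r = td b c" and "w = td r p"
  have X: "p \<in> X" "r \<in> X" "w \<in> X" and wr: "R w r = p" "L w r = dt p r"
    using assms by (simp_all add: p_def r_def w_def)
  have rb: "R r b = c" "L r b = dt c b" and pb: "R p b = a" "L p b = dt a b"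
    using assms by (simp_all add: p_def r_def)
  have "R (R w (dt c b)) c = a"
    using yang_baxter(3)[of w r b] X assms wr pb rb by simp
  then have "R w (dt c b) = td c a"
    using td_R[of "R w (dt c b)" c] X assms by simp
  then have "R (dt p r) (dt a b) = dt a c"
    using yang_baxter(2)[of w r b] X assms wr pb rb by simp
  then have "td (dt a b) (dt a c) = dt p r"
    using td_R[of "dt p r" "dt a b"] X assms by simp
  then show ?thesis by (simp add: p_def r_def)
qed

lemma dt_dt:
  assumes "a \<in> X" "b \<in> X" "c \<in> X"
  shows "dt (td b a) (dt b c) = dt (dt a b) (dt a c)"
proof -
  \<comment> \<open>Here the triple is (w, r, c), with \<open>R r c = b\<close> and
    \<open>R w (dt b c) = p\<close>. All three components enter, the first one in the final
    comparison.\<close>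
  define p r w where "p = td b a" and "r = td c b" and "w = td (dt b c) p"
  have X: "p \<in> X" "r \<in> X" "w \<in> X" and w: "R w (dt b c) = p" "L w (dt b c) = dt p (dt b c)"
    using assms by (simp_all add: p_def r_def w_def)
  have rc: "R r c = b" "L r c = dt b c" and pb: "R p b = a" "L p b = dt a b"
    using assms by (simp_all add: p_def r_def)
  have "R (R w r) c = a"
    using yang_baxter(3)[of w r c] X assms w rc pb by simp
  then have wr: "R w r = td c a"
    using td_R[of "R w r" c] X assms by simp
  then have "R (L w r) (dt a c) = dt a b"
    using yang_baxter(2)[of w r c] X assms w rc pb by simp
  then have "L w r = td (dt a c) (dt a b)"
    using td_R[of "L w r" "dt a c"] X assms by simp
  then have "L (L w r) (dt a c) = dt (dt a b) (dt a c)" by simp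
  moreover have "L (L w r) (dt a c) = dt p (dt b c)"
    using yang_baxter(1)[of w r c] X assms w rc wr by simp
  ultimately show ?thesis by (simp add: p_def)
qed

section \<open>Contractions and edges\<close>

definition reduce :: "nat \<Rightarrow> 'x list \<Rightarrow> 'x list"
  where "reduce j ys = map (td (ys ! j)) (take j ys) @ map (dt (ys ! j)) (drop (Suc j) ys)"

lemma length_reduce [simp]: "j < length ys \<Longrightarrow> length (reduce j ys) = length ys - 1"
  by (simp add: reduce_def)

lemma nth_reduce:
  "j < length ys \<Longrightarrow> l < length ys - 1 \<Longrightarrow>
    reduce j ys ! l = (if l < j then td (ys ! j) (ys ! l) else dt (ys ! j) (ys ! Suc l))"
  by (auto simp: reduce_def nth_append)

lemma set_reduce:
  assumes "j < length ys" "set ys \<subseteq> X"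
  shows "set (reduce j ys) \<subseteq> X"
proof -
  have "ys ! j \<in> X" using assms by auto
  then show ?thesis
    using assms(2) by (fastforce simp: reduce_def dest: in_set_takeD in_set_dropD)
qed

lemma reduce_reduce:
  assumes "i < j" "j < length ys" "set ys \<subseteq> X"
  shows "reduce i (reduce j ys) = reduce (j - 1) (reduce i ys)"
proof (rule nth_equalityI)
  show "length (reduce i (reduce j ys)) = length (reduce (j - 1) (reduce i ys))"
    using assms by simp
next
  fix l assume "l < length (reduce i (reduce j ys))"
  then have l: "l < length ys - 2" using assms by simp
  have X: "ys ! i \<in> X" "ys ! j \<in> X" "ys ! l \<in> X" "ys ! Suc l \<in> X" "ys ! Suc (Suc l) \<in> X"
    using assms l by (auto intro!: subsetD[OF assms(3)] nth_mem)
  have j1: "Suc (j - 1) = j" using assms by simp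
  \<comment> \<open>The entry ending up at \<open>l\<close> stood before, between or after the two
    contracted positions; these are the cases of \<open>td_td\<close>, \<open>dt_td\<close> and
    \<open>dt_dt\<close>.\<close>
  consider "l < i" | "i \<le> l" "l < j - 1" | "j - 1 \<le> l" by linarith
  then show "reduce i (reduce j ys) ! l = reduce (j - 1) (reduce i ys) ! l"
    using assms l X by cases (auto simp: nth_reduce td_td dt_td dt_dt j1)
qed

lemma remove_reduce:
  assumes "j \<noteq> l" "j < length ys" "l < length ys"
  shows "remove (shift l j) (reduce l ys) = reduce (shift j l) (remove j ys)"
  using assms
  by (intro nth_equalityI) (auto simp: shift_def nth_reduce nth_remove)

text \<open>Both copies lie on the same side of position l and are changed alike.\<close>

lemma dup_reduce:
  assumes "i \<noteq> l" "i < length ys" "l < length ys"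
  shows "dup (shift l i) (reduce l ys) = reduce (if l < i then l else Suc l) (dup i ys)"
proof (cases "l < i")
  case True
  then show ?thesis using assms
    by (intro nth_equalityI) (auto simp: shift_def nth_reduce nth_dup)
next
  case False
  then show ?thesis using assms
    by (intro nth_equalityI) (auto simp: shift_def nth_reduce nth_dup)
qed

text \<open>\<open>edge i ys\<close> is the entry that remains of \<open>ys\<close> when \<open>reduce\<close> is applied at all positions
  but the \<open>i\<close>-th; by the pre-cubical relations the order does not matter.\<close>

fun edge :: "nat \<Rightarrow> 'x list \<Rightarrow> 'x" where
  "edge (Suc i) (y # ys) = edge i (map (dt y) ys)"
| "edge 0 (z # y # ys) = edge 0 (td y z # map (dt y) ys)"
| "edge 0 [z] = z"
| "edge _ [] = undefined"

lemma edge_Suc: "ys \<noteq> [] \<Longrightarrow> edge (Suc i) ys = edge i (reduce 0 ys)"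
  by (cases ys) (auto simp: reduce_def)

lemma edge_0: "1 < length ys \<Longrightarrow> edge 0 ys = edge 0 (reduce 1 ys)"
  by (cases ys; cases "tl ys") (auto simp: reduce_def)

text \<open>\<open>edge\<close> contracts position 0 first, or position 1 when 0 is kept. As
  contractions commute, the contraction at j can be moved behind this first one, and induction on
  the length applies.\<close>

lemma edge_reduce:
  assumes "set ys \<subseteq> X" "i < length ys" "j < length ys" "i \<noteq> j"
  shows "edge (shift j i) (reduce j ys) = edge i ys"
  using assms
proof (induction "length ys" arbitrary: ys i j rule: less_induct)
  case less
  have ne: "ys \<noteq> []" using less.prems by auto
  show ?case
  proof (cases i)
    case (Suc i')
    show ?thesis
    proof (cases j)
      case 0
      then show ?thesis using Suc ne by (simp add: shift_def edge_Suc)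
    next
      case (Suc j')
      have i': "shift j i = Suc (shift j' i')"
        using \<open>i = Suc i'\<close> Suc less.prems(4) by (auto simp: shift_def)
      have "reduce j ys \<noteq> []"
        using length_reduce[of j ys] less.prems \<open>i = Suc i'\<close> Suc by fastforce
      then have "edge (shift j i) (reduce j ys) = edge (shift j' i') (reduce j' (reduce 0 ys))"
        using i' reduce_reduce[of 0 j ys] less.prems Suc by (simp add: edge_Suc)
      also have "\<dots> = edge i' (reduce 0 ys)"
        using ne less.prems \<open>i = Suc i'\<close> Suc
        by (intro less.hyps set_reduce) auto
      finally show ?thesis using \<open>i = Suc i'\<close> ne by (simp add: edge_Suc)
    qed
  next
    case 0
    show ?thesis
    proof (cases "j = 1")
      case True
      then show ?thesis using 0 less.prems edge_0[of ys] by (simp add: shift_def)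
    next
      case False
      then have j: "1 < j" using 0 less.prems by simp
      have "edge (shift j i) (reduce j ys) = edge 0 (reduce (j - 1) (reduce 1 ys))"
        using 0 j less.prems edge_0[of "reduce j ys"] reduce_reduce[of 1 j ys]
        by (simp add: shift_def)
      also have "\<dots> = edge 0 (reduce 1 ys)"
        using less.hyps[of "reduce 1 ys" 0 "j - 1"] less.prems j set_reduce[of 1 ys]
        by (simp add: shift_def)
      finally show ?thesis using 0 j less.prems edge_0[of ys] by simp
    qed
  qed
qed

lemma edge_closed:
  assumes "set ys \<subseteq> X" "i < length ys"
  shows "edge i ys \<in> X"
  using assms
proof (induction i ys rule: edge.induct)
  case (1 i y ys)
  then show ?case by simp
next
  case (2 z y ys)
  then show ?case by simp
qed auto


section \<open>The guitar map\<close>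

text \<open>\<open>edge\<close> is defined from the left, whereas the outermost action in the guitar
  map is that of the last entry; contracting that entry first reconciles the two.\<close>

lemma edge_snoc:
  assumes "set (ys @ [w]) \<subseteq> X" "i < length ys"
  shows "edge i (ys @ [w]) = edge i (map (td w) ys)"
  using edge_reduce[of "ys @ [w]" i "length ys"] assms by (simp add: shift_def reduce_def)

lemma guitar_Cons: "guitar \<sigma> (x # xs) = foldl R x xs # guitar \<sigma> xs"
  unfolding guitar_def by (simp add: upt_conv_Cons map_Suc_upt[symmetric] del: upt_Suc)

lemma foldl_R_inject:
  assumes "foldl R x xs = foldl R y xs" "x \<in> X" "y \<in> X" "set xs \<subseteq> X"
  shows "x = y"
  using assms
proof (induction xs arbitrary: x y)
  case (Cons a xs)
  then have "R x a = R y a"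
    by (intro Cons.IH[of "R x a" "R y a"]) auto
  then have "td a (R x a) = td a (R y a)" by simp
  then show ?case using Cons.prems by simp
qed auto

text \<open>The guitar map is triangular: the tail of the image depends only on the tail, and the
  head enters through a composite of injective right actions.\<close>

lemma guitar_inject:
  assumes "guitar \<sigma> xs = guitar \<sigma> ys" "set xs \<subseteq> X" "set ys \<subseteq> X"
  shows "xs = ys"
  using assms
proof (induction xs arbitrary: ys)
  case Nil
  then show ?case by (simp add: guitar_def)
next
  case (Cons x xs)
  from Cons.prems(1) obtain y ys' where ys: "ys = y # ys'"
    by (cases ys) (simp_all add: guitar_def)
  have "xs = ys'" using Cons.IH[of ys'] Cons.prems by (simp add: guitar_Cons ys)
  then show ?case
    using Cons.prems ys foldl_R_inject[of x xs y] by (auto simp: guitar_Cons)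
qed

text \<open>The explicit inverse of the guitar map, built from the first-direction edges of all
  suffixes. In particular \<open>edge 0\<close> computes its first component.\<close>

primrec unguitar :: "'x list \<Rightarrow> 'x list" where
  "unguitar [] = []"
| "unguitar (y # ys) = edge 0 (y # ys) # unguitar ys"

lemma length_unguitar [simp]: "length (unguitar ys) = length ys"
  by (induction ys) auto

lemma set_unguitar: "set ys \<subseteq> X \<Longrightarrow> set (unguitar ys) \<subseteq> X"
  by (induction ys) (auto intro!: edge_closed)

lemma unguitar_snoc:
  "set (ys @ [w]) \<subseteq> X \<Longrightarrow> unguitar (ys @ [w]) = unguitar (map (td w) ys) @ [w]"
proof (induction ys)
  case (Cons y ys)
  then have "edge 0 ((y # ys) @ [w]) = edge 0 (map (td w) (y # ys))"
    by (intro edge_snoc) auto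
  then show ?case using Cons by simp
qed simp

text \<open>Splitting off the last entry w replaces y by \<open>td w y\<close>, and the final action
  by w undoes this. Induction is on the length because the remaining entries change.\<close>

lemma foldl_unguitar:
  "set (y # ys) \<subseteq> X \<Longrightarrow> foldl R (edge 0 (y # ys)) (unguitar ys) = y"
proof (induction "length ys" arbitrary: y ys)
  case 0
  then show ?case by simp
next
  case (Suc n)
  then obtain zs w where ys: "ys = zs @ [w]"
    by (cases ys rule: rev_cases) auto
  have "edge 0 (y # ys) = edge 0 (map (td w) (y # zs))"
    using edge_snoc[of "y # zs" w 0] Suc.prems ys by simp
  moreover have "foldl R (edge 0 (td w y # map (td w) zs)) (unguitar (map (td w) zs)) = td w y"
    using Suc.hyps(1)[of "map (td w) zs" "td w y"] Suc.hyps(2) Suc.prems ys by simp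
  ultimately show ?case
    using Suc.prems ys by (simp add: unguitar_snoc)
qed

lemma guitar_unguitar: "set ys \<subseteq> X \<Longrightarrow> guitar \<sigma> (unguitar ys) = ys"
proof (induction ys)
  case (Cons y ys)
  then show ?case using foldl_unguitar[of y ys] by (simp add: guitar_Cons)
qed (simp add: guitar_def)

lemma guitar_inv_eq:
  assumes "set ys \<subseteq> X"
  shows "guitar_inv X \<sigma> ys = unguitar ys"
  unfolding guitar_inv_def
proof (rule inv_into_f_eq)
  show "inj_on (guitar \<sigma>) (tuples X (length ys))"
    by (auto simp: inj_on_def tuples_def intro: guitar_inject)
  show "unguitar ys \<in> tuples X (length ys)"
    using set_unguitar[OF assms] by (simp add: tuples_def)
  show "guitar \<sigma> (unguitar ys) = ys" using assms by (rule guitar_unguitar)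
qed

section \<open>Moving an entry to the front\<close>

lemma tri_closed [simp, intro]: "a \<in> X \<Longrightarrow> b \<in> X \<Longrightarrow> tri X \<sigma> a b \<in> X"
  by (simp add: tri_def)

lemma foldl_tri_closed: "x \<in> X \<Longrightarrow> set xs \<subseteq> X \<Longrightarrow> foldl (tri X \<sigma>) x xs \<in> X"
  by (induction xs arbitrary: x) auto

text \<open>Contracting w gives the same tuple in both lists, since
  \<open>td w (tri X \<sigma> z w) = dt w z\<close>.\<close>

lemma edge_swap:
  assumes "set us \<subseteq> X" "set vs \<subseteq> X" "z \<in> X" "w \<in> X"
  shows "edge (length us) (us @ tri X \<sigma> z w # w # vs) = edge (Suc (length us)) (us @ w # z # vs)"
proof -
  have "edge (length us) (us @ tri X \<sigma> z w # w # vs) =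
      edge (length us) (reduce (Suc (length us)) (us @ tri X \<sigma> z w # w # vs))"
    using edge_reduce[of "us @ tri X \<sigma> z w # w # vs" "length us" "Suc (length us)"] assms
    by (simp add: shift_def)
  moreover have "edge (Suc (length us)) (us @ w # z # vs) =
      edge (length us) (reduce (length us) (us @ w # z # vs))"
    using edge_reduce[of "us @ w # z # vs" "Suc (length us)" "length us"] assms
    by (simp add: shift_def)
  moreover have "reduce (Suc (length us)) (us @ tri X \<sigma> z w # w # vs) =
      reduce (length us) (us @ w # z # vs)"
    using assms by (simp add: reduce_def nth_append tri_def)
  ultimately show ?thesis by simp
qed

lemma edge_foldl_tri:
  assumes "set us \<subseteq> X" "set vs \<subseteq> X" "z \<in> X"
  shows "edge 0 (foldl (tri X \<sigma>) z (rev us) # us @ vs) = edge (length us) (us @ z # vs)"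
  using assms
proof (induction us arbitrary: z vs rule: rev_induct)
  case (snoc w us)
  then show ?case using snoc.IH[of "w # vs" "tri X \<sigma> z w"] edge_swap[of us vs z w] by simp
qed simp

text \<open>\<open>chi\<close> moves the chosen entry to the front by \<open>tri\<close> and takes
  the first component of the inverse guitar map, which is \<open>edge 0\<close>; by
  \<open>edge_foldl_tri\<close> the move preserves the edge.\<close>

lemma chi_eq_edge:
  assumes "set ys \<subseteq> X" "i < length ys"
  shows "chi X \<sigma> (Suc i) ys = edge i ys"
proof -
  let ?us = "take i ys" and ?vs = "drop (Suc i) ys" and ?z = "ys ! i"
  have X: "set ?us \<subseteq> X" "set ?vs \<subseteq> X" "?z \<in> X"
    using assms by (auto dest: in_set_takeD in_set_dropD)
  have ys: "?us @ ?z # ?vs = ys" using assms(2) by (simp add: id_take_nth_drop[symmetric])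
  have "chi X \<sigma> (Suc i) ys = hd (unguitar (foldl (tri X \<sigma>) ?z (rev ?us) # ?us @ ?vs))"
    unfolding chi_def diff_Suc_1 using X foldl_tri_closed[of ?z "rev ?us"]
    by (subst guitar_inv_eq) auto
  also have "\<dots> = edge i ys"
    using edge_foldl_tri[OF X] ys assms(2) by simp
  finally show ?thesis .
qed

end


section \<open>Boundaries and degeneracies\<close>

locale RI_compatible_modules = nondegenerate_braiding X \<sigma>
  for X :: "'x set" and \<sigma> :: "'x \<times> 'x \<Rightarrow> 'x \<times> 'x" +
  fixes t :: "'x \<Rightarrow> 'x" and M :: "'m set" and ra :: "'m \<Rightarrow> 'x \<Rightarrow> 'm"
    and N :: "'n set" and la :: "'x \<Rightarrow> 'n \<Rightarrow> 'n"
  assumes RI: "weakly_RI_compatible X \<sigma> t"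
    and solid: "solid_right_module X \<sigma> M ra"
    and left: "left_module X \<sigma> N la"
begin

lemma t_closed [simp, intro]: "a \<in> X \<Longrightarrow> t a \<in> X"
  using RI by (auto simp: weakly_RI_compatible_def)

text \<open>The second component of \<open>\<sigma> (t a, a) = (t a, a)\<close> says that
  \<open>t a\<close> is the solution c of \<open>R c a = a\<close>; the first component gives
  \<open>dt_self\<close>.\<close>

lemma td_self: "a \<in> X \<Longrightarrow> td a a = t a"
  using RI td_R[of "t a" a] by (simp add: weakly_RI_compatible_def rpart_def)

lemma dt_self: "a \<in> X \<Longrightarrow> dt a a = t a"
  unfolding dot_def using RI by (simp add: td_self weakly_RI_compatible_def lpart_def)

text \<open>The results could differ only in the surviving copy of the repeated entry y, which
  becomes \<open>dt y y\<close> in one and \<open>td y y\<close> in the other.\<close>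

lemma reduce_dup_self:
  assumes "i < length ys" "set ys \<subseteq> X"
  shows "reduce i (dup i ys) = reduce (Suc i) (dup i ys)"
proof (rule nth_equalityI)
  fix l assume "l < length (reduce i (dup i ys))"
  then have l: "l < length ys" using assms by simp
  have "ys ! i \<in> X" using assms by auto
  then show "reduce i (dup i ys) ! l = reduce (Suc i) (dup i ys) ! l"
    using assms l by (cases l i rule: linorder_cases) (simp_all add: nth_reduce nth_dup td_self dt_self)
qed (use assms in simp)

text \<open>Contractions at other positions commute with \<open>dup\<close> and preserve edges. This
  leaves a single entry y, and the edges of \<open>[y, y]\<close> are \<open>td y y\<close> and
  \<open>dt y y\<close>.\<close>

lemma edge_dup_self:
  assumes "i < length ys" "set ys \<subseteq> X"
  shows "edge i (dup i ys) = t (edge i ys)" "edge (Suc i) (dup i ys) = t (edge i ys)"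
proof -
  have "edge i (dup i ys) = t (edge i ys) \<and> edge (Suc i) (dup i ys) = t (edge i ys)"
    using assms
  proof (induction "length ys" arbitrary: ys i rule: less_induct)
    case less
    show ?case
    proof (cases "length ys = 1")
      case True
      then obtain y where "ys = [y]" by (auto simp: length_Suc_conv)
      then show ?thesis using less.prems by (simp add: dup_def td_self dt_self)
    next
      case False
      define l :: nat where "l = (if i = 0 then 1 else 0)"
      have l: "l \<noteq> i" "l < length ys" using False less.prems by (auto simp: l_def)
      \<comment> \<open>The position of the entry \<open>l\<close> in the longer list
        \<open>dup i ys\<close>.\<close>
      let ?l = "if l < i then l else Suc l"
      have X: "set (dup i ys) \<subseteq> X" using set_dup[of i ys] less.prems by blast
      have "edge (shift l i) (dup (shift l i) (reduce l ys)) = t (edge (shift l i) (reduce l ys)) \<and>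
          edge (Suc (shift l i)) (dup (shift l i) (reduce l ys)) = t (edge (shift l i) (reduce l ys))"
        using l less.prems set_reduce[of l ys] by (intro less.hyps) (auto simp: shift_def)
      moreover have "edge (shift l i) (reduce l ys) = edge i ys"
        using l less.prems by (intro edge_reduce) auto
      moreover have "edge (shift l i) (dup (shift l i) (reduce l ys)) = edge i (dup i ys)"
        using dup_reduce[of i l ys] edge_reduce[OF X, of i ?l] l less.prems
        by (auto simp: shift_def split: if_splits)
      moreover have "edge (Suc (shift l i)) (dup (shift l i) (reduce l ys)) = edge (Suc i) (dup i ys)"
        using dup_reduce[of i l ys] edge_reduce[OF X, of "Suc i" ?l] l less.prems
        by (auto simp: shift_def split: if_splits)
      ultimately show ?thesis by simp
    qed
  qed
  then show "edge i (dup i ys) = t (edge i ys)" "edge (Suc i) (dup i ys) = t (edge i ys)" by auto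
qed

section \<open>Actions of edges on the modules\<close>

lemma ra_closed [simp, intro]: "m \<in> M \<Longrightarrow> a \<in> X \<Longrightarrow> ra m a \<in> M"
  using solid unfolding solid_right_module_def right_module_def by blast

lemma ra_ra:
  "m \<in> M \<Longrightarrow> a \<in> X \<Longrightarrow> b \<in> X \<Longrightarrow> ra (ra m a) b = ra (ra m (L a b)) (R a b)"
  using solid unfolding solid_right_module_def right_module_def by blast

lemma bij_ra: "a \<in> X \<Longrightarrow> bij_betw (\<lambda>m. ra m a) M M"
  using solid by (simp add: solid_right_module_def)

abbreviation "rinv \<equiv> act_inverse M ra"

lemma rinv_closed [simp, intro]: "m \<in> M \<Longrightarrow> a \<in> X \<Longrightarrow> rinv m a \<in> M"
  unfolding act_inverse_def by (rule bij_betw_apply[OF bij_betw_inv_into[OF bij_ra]])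

lemma ra_rinv [simp]: "m \<in> M \<Longrightarrow> a \<in> X \<Longrightarrow> ra (rinv m a) a = m"
  unfolding act_inverse_def by (rule bij_betw_inv_into_right[OF bij_ra])

lemma rinv_ra [simp]: "m \<in> M \<Longrightarrow> a \<in> X \<Longrightarrow> rinv (ra m a) a = m"
  unfolding act_inverse_def by (rule bij_betw_inv_into_left[OF bij_ra])

lemma la_closed [simp, intro]: "n \<in> N \<Longrightarrow> a \<in> X \<Longrightarrow> la a n \<in> N"
  using left unfolding left_module_def by blast

lemma la_la:
  assumes "n \<in> N" "a \<in> X" "b \<in> X"
  shows "la (td b a) (la b n) = la (dt a b) (la a n)"
proof -
  have "la (td b a) (la b n) = la (L (td b a) b) (la (R (td b a) b) n)"
    using left assms(1,3) td_closed[OF assms(2,3)] unfolding left_module_def by blast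
  then show ?thesis using assms by simp
qed

text \<open>Contracting a third position commutes with \<open>remove\<close> and changes none of the
  four edges. For \<open>[a, b]\<close> the claim is the right module axiom for
  \<open>td b a\<close> and b.\<close>

lemma ra_edge_commute:
  assumes "i < j" "j < length ys" "set ys \<subseteq> X" "m \<in> M"
  shows "ra (ra m (edge j ys)) (edge i (remove j ys)) =
    ra (ra m (edge i ys)) (edge (j - 1) (remove i ys))"
  using assms
proof (induction "length ys" arbitrary: ys i j rule: less_induct)
  case less
  show ?case
  proof (cases "length ys = 2")
    case True
    then obtain a b where ys: "ys = [a, b]"
      by (auto simp: numeral_2_eq_2 length_Suc_conv)
    have ij: "i = 0" "j = 1" using less.prems True by auto
    show ?thesis
      using ra_ra[of m "td b a" b] less.prems by (simp add: ys ij remove_def)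
  next
    case False
    \<comment> \<open>The least position other than i and j, available since the length is at least
      3.\<close>
    define l :: nat where "l = (if i \<noteq> 0 then 0 else if j \<noteq> 1 then 1 else 2)"
    have l: "l \<noteq> i" "l \<noteq> j" "l < length ys" using False less.prems by (auto simp: l_def)
    have X: "set (remove i ys) \<subseteq> X" "set (remove j ys) \<subseteq> X"
      by (rule subset_trans[OF set_remove less.prems(3)])+
    have "ra (ra m (edge (shift l j) (reduce l ys))) (edge (shift l i) (remove (shift l j) (reduce l ys))) =
        ra (ra m (edge (shift l i) (reduce l ys)))
          (edge (shift l j - 1) (remove (shift l i) (reduce l ys)))"
    proof (rule less.hyps)
      show "shift l i < shift l j" "shift l j < length (reduce l ys)"
        using less.prems l by (auto simp: shift_def)
    qed (use less.prems l in \<open>auto dest: set_reduce[THEN subsetD]\<close>)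
    moreover have "edge (shift l j) (reduce l ys) = edge j ys"
      "edge (shift l i) (reduce l ys) = edge i ys"
      using less.prems l by (simp_all add: edge_reduce)
    moreover have "edge (shift l i) (remove (shift l j) (reduce l ys)) = edge i (remove j ys)"
    proof -
      have "shift (shift j l) i = shift l i" "shift j l < length ys - 1"
        "i \<noteq> shift j l" "i < length ys - 1"
        using less.prems l by (auto simp: shift_def)
      then show ?thesis
        using remove_reduce[of j l ys] edge_reduce[OF X(2), of i "shift j l"] less.prems l
        by simp
    qed
    moreover have "edge (shift l j - 1) (remove (shift l i) (reduce l ys)) = edge (j - 1) (remove i ys)"
    proof -
      have "shift (shift i l) (j - 1) = shift l j - 1" "shift i l < length ys - 1"
        "j - 1 \<noteq> shift i l" "j - 1 < length ys - 1"
        using less.prems l by (auto simp: shift_def)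
      then show ?thesis
        using remove_reduce[of i l ys] edge_reduce[OF X(1), of "j - 1" "shift i l"] less.prems l
        by simp
    qed
    ultimately show ?thesis by simp
  qed
qed

text \<open>\<open>ra_edge_commute\<close> for \<open>dup j ys\<close> at i and
  \<open>Suc j\<close>: deleting the copy restores \<open>ys\<close>, its edge cancels the inverse
  action, and solidity allows solving for the remaining term.\<close>

lemma ra_rinv_dup_less:
  assumes "i < j" "j < length ys" "set ys \<subseteq> X" "m \<in> M"
  shows "ra (rinv m (t (edge j ys))) (edge i (dup j ys)) =
    rinv (ra m (edge i ys)) (t (edge (j - 1) (remove i ys)))"
proof -
  let ?m = "rinv m (t (edge j ys))"
  have X: "edge i ys \<in> X" "edge j ys \<in> X" "edge i (dup j ys) \<in> X" "edge (j - 1) (remove i ys) \<in> X"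
    "set (dup j ys) \<subseteq> X" "set (remove i ys) \<subseteq> X"
    using assms set_dup[of j ys] set_remove[of i ys] by (auto intro!: edge_closed)
  have "ra (ra ?m (edge (Suc j) (dup j ys))) (edge i (remove (Suc j) (dup j ys))) =
      ra (ra ?m (edge i (dup j ys))) (edge j (remove i (dup j ys)))"
    using ra_edge_commute[of i "Suc j" "dup j ys" ?m] X assms by simp
  moreover have "edge j (remove i (dup j ys)) = t (edge (j - 1) (remove i ys))"
    using edge_dup_self(2)[of "j - 1" "remove i ys"] remove_dup_less[of i j ys] X assms by simp
  ultimately have "ra m (edge i ys) = ra (ra ?m (edge i (dup j ys))) (t (edge (j - 1) (remove i ys)))"
    using X assms by (simp add: edge_dup_self remove_dup_same)
  then show ?thesis using X assms by simp
qed

lemma ra_rinv_dup_greater: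
  assumes "j < i" "i < length ys" "set ys \<subseteq> X" "m \<in> M"
  shows "ra (rinv m (t (edge j ys))) (edge (Suc i) (dup j ys)) =
    rinv (ra m (edge i ys)) (t (edge j (remove i ys)))"
proof -
  let ?m = "rinv m (t (edge j ys))"
  have X: "edge i ys \<in> X" "edge j ys \<in> X" "edge (Suc i) (dup j ys) \<in> X" "edge j (remove i ys) \<in> X"
    "set (dup j ys) \<subseteq> X" "set (remove i ys) \<subseteq> X"
    using assms set_dup[of j ys] set_remove[of i ys] by (auto intro!: edge_closed)
  have "ra (ra ?m (edge (Suc i) (dup j ys))) (edge j (remove (Suc i) (dup j ys))) =
      ra (ra ?m (edge j (dup j ys))) (edge i (remove j (dup j ys)))"
    using ra_edge_commute[of j "Suc i" "dup j ys" ?m] X assms by simp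
  moreover have "edge j (remove (Suc i) (dup j ys)) = t (edge j (remove i ys))"
    using edge_dup_self(1)[of j "remove i ys"] remove_dup_greater[of j i ys] X assms by simp
  ultimately have "ra m (edge i ys) = ra (ra ?m (edge (Suc i) (dup j ys))) (t (edge j (remove i ys)))"
    using X assms by (simp add: edge_dup_self remove_dup_same)
  then show ?thesis using X assms by simp
qed

lemma rinv_rinv_dup:
  assumes "i \<le> j" "j < length ys" "set ys \<subseteq> X" "m \<in> M"
  shows "rinv (rinv m (t (edge j ys))) (t (edge i (dup j ys))) =
    rinv (rinv m (t (edge i ys))) (t (edge (Suc j) (dup i ys)))"
proof (cases "i = j")
  case True
  then show ?thesis using assms by (simp add: edge_dup_self)
next
  case False
  let ?ws = "dup i (dup j ys)"
  \<comment> \<open>Chosen so that acting by one copy of each repeated entry, in one order, returns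
    m; \<open>ra_edge_commute\<close> evaluates the other order, which is then inverted.\<close>
  let ?m = "rinv (rinv m (t (edge i ys))) (t (edge (Suc j) (dup i ys)))"
  have S: "set (dup j ys) \<subseteq> X" "set (dup i ys) \<subseteq> X" "set ?ws \<subseteq> X"
    using assms set_dup[of j ys] set_dup[of i ys] set_dup[of i "dup j ys"] by auto
  have X: "edge i ys \<in> X" "edge j ys \<in> X" "edge i (dup j ys) \<in> X" "edge (Suc j) (dup i ys) \<in> X"
    using assms S by (auto intro!: edge_closed)
  have ws: "?ws = dup (Suc j) (dup i ys)" using assms by (intro dup_dup)
  have "ra (ra ?m (edge i ?ws)) (edge (Suc j) (remove i ?ws)) =
      ra (ra ?m (edge (Suc (Suc j)) ?ws)) (edge i (remove (Suc (Suc j)) ?ws))"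
    using ra_edge_commute[of i "Suc (Suc j)" ?ws ?m] S X assms by simp
  moreover have "edge (Suc (Suc j)) ?ws = t (edge (Suc j) (dup i ys))"
    "edge i (remove (Suc (Suc j)) ?ws) = t (edge i ys)"
    unfolding ws using S assms by (simp_all add: edge_dup_self remove_dup_same)
  moreover have "edge i ?ws = t (edge i (dup j ys))" "edge (Suc j) (remove i ?ws) = t (edge j ys)"
    using S assms by (simp_all add: edge_dup_self remove_dup_same)
  ultimately have "ra (ra ?m (t (edge i (dup j ys)))) (t (edge j ys)) =
      ra (ra ?m (t (edge (Suc j) (dup i ys)))) (t (edge i ys))"
    by (simp only:)
  also have "\<dots> = m" using X assms by simp
  finally have "rinv (rinv (ra (ra ?m (t (edge i (dup j ys)))) (t (edge j ys))) (t (edge j ys)))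
      (t (edge i (dup j ys))) = rinv (rinv m (t (edge j ys))) (t (edge i (dup j ys)))"
    by (simp only:)
  then show ?thesis using X assms by simp
qed

section \<open>Verification of the cubical identities\<close>

abbreviation "dm \<equiv> bd X \<sigma> la"
abbreviation "dp \<equiv> bd' X \<sigma> ra"
abbreviation "sg \<equiv> degen X \<sigma> M ra t"

lemma bd_eq: "dm (Suc i) (m, ys, n) = (m, reduce i ys, la (ys ! i) n)"
  by (simp add: bd_def reduce_def Let_def)

lemma bd'_eq:
  "set ys \<subseteq> X \<Longrightarrow> i < length ys \<Longrightarrow> dp (Suc i) (m, ys, n) = (ra m (edge i ys), remove i ys, n)"
  by (simp add: bd'_def remove_def chi_eq_edge)

lemma degen_eq:
  "set ys \<subseteq> X \<Longrightarrow> i < length ys \<Longrightarrow>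
    sg (Suc i) (m, ys, n) = (rinv m (t (edge i ys)), dup i ys, n)"
  by (simp add: degen_def dup_def chi_eq_edge)

lemma cells_cases:
  assumes "x \<in> cells X M N k"
  obtains m ys n where "x = (m, ys, n)" "m \<in> M" "n \<in> N" "set ys \<subseteq> X" "length ys = k"
  using assms unfolding cells_def tuples_def by auto

lemmas edge_closed_simps = edge_closed subset_trans[OF set_dup] subset_trans[OF set_remove] set_reduce

lemma pre_cubical_cells: "pre_cubical (cells X M N) (face X \<sigma> ra la)"
  unfolding pre_cubical_def
proof (intro conjI allI impI ballI)
  fix \<epsilon> :: sign and k i :: nat
  assume ik: "1 \<le> i \<and> i \<le> k"
  then obtain i' where i': "i = Suc i'" by (cases i) auto
  show "face X \<sigma> ra la \<epsilon> k i \<in> cells X M N k \<rightarrow> cells X M N (k - 1)"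
  proof
    fix x assume "x \<in> cells X M N k"
    then show "face X \<sigma> ra la \<epsilon> k i x \<in> cells X M N (k - 1)"
      using ik i' by (elim cells_cases, cases \<epsilon>)
        (auto simp: face_def bd_eq bd'_eq cells_def tuples_def edge_closed_simps
          intro!: la_closed subsetD[OF _ nth_mem] dest: subsetD[OF set_remove] subsetD[OF set_reduce])
  qed
next
  fix \<epsilon> \<zeta> :: sign and k i j :: nat and x :: "'m \<times> 'x list \<times> 'n"
  assume ij: "1 \<le> i \<and> i < j \<and> j \<le> k" and "x \<in> cells X M N k"
  then obtain m ys n where x: "x = (m, ys, n)" "m \<in> M" "n \<in> N" "set ys \<subseteq> X" "length ys = k"
    by (elim cells_cases)
  \<comment> \<open>Counted from 0, the indices i, j and j - 1 become \<open>i'\<close>,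
    \<open>Suc j'\<close> and \<open>j'\<close>.\<close>
  obtain i' j' where i': "i = Suc i'" and j': "j = Suc (Suc j')"
    using ij by (cases i; cases j; cases "j - 1") auto
  have l: "i' < k" "Suc j' < k" "i' \<le> j'" using ij i' j' by auto
  have X: "ys ! i' \<in> X" "ys ! Suc j' \<in> X" using x l by auto
  show "face X \<sigma> ra la \<epsilon> (k - 1) i (face X \<sigma> ra la \<zeta> k j x) =
      face X \<sigma> ra la \<zeta> (k - 1) (j - 1) (face X \<sigma> ra la \<epsilon> k i x)"
  \<comment> \<open>Equal signs rest on the right or the left module axiom; for mixed signs the
    label \<chi> is unchanged by the other contraction.\<close>
  proof (cases \<epsilon>; cases \<zeta>)
    assume e: "\<epsilon> = Pos" "\<zeta> = Pos"
    show ?thesis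
      using x l ra_edge_commute[of i' "Suc j'" ys m] remove_remove[of i' "Suc j'" ys]
      by (simp add: e face_def i' j' bd'_eq edge_closed_simps)
  next
    assume e: "\<epsilon> = Pos" "\<zeta> = Neg"
    have "ys ! Suc j' = remove i' ys ! j'" using x l by (simp add: nth_remove)
    then show ?thesis
      using x l edge_reduce[of ys i' "Suc j'"] remove_reduce[of i' "Suc j'" ys]
      by (simp add: e face_def i' j' bd'_eq bd_eq edge_closed_simps shift_def)
  next
    assume e: "\<epsilon> = Neg" "\<zeta> = Pos"
    have "ys ! i' = remove (Suc j') ys ! i'" using x l by (simp add: nth_remove)
    then show ?thesis
      using x l edge_reduce[of ys "Suc j'" i'] remove_reduce[of "Suc j'" i' ys]
      by (simp add: e face_def i' j' bd'_eq bd_eq edge_closed_simps shift_def)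
  next
    assume e: "\<epsilon> = Neg" "\<zeta> = Neg"
    show ?thesis
      using x l reduce_reduce[of i' "Suc j'" ys] X la_la[of n "ys ! i'" "ys ! Suc j'"]
      by (simp add: e face_def i' j' bd_eq nth_reduce)
  qed
qed

lemma semi_strong_skew_cubical_cells:
  "semi_strong_skew_cubical (cells X M N) (face X \<sigma> ra la) (\<lambda>k. sg)"
  unfolding semi_strong_skew_cubical_def
proof (intro conjI[OF pre_cubical_cells] conjI allI impI ballI)
  fix k i :: nat
  assume ik: "1 \<le> i \<and> i \<le> k"
  then obtain i' where i': "i = Suc i'" by (cases i) auto
  show "sg i \<in> (cells X M N k :: ('m \<times> 'x list \<times> 'n) set) \<rightarrow> cells X M N (k + 1)"
  proof
    fix x :: "'m \<times> 'x list \<times> 'n" assume "x \<in> cells X M N k"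
    then show "sg i x \<in> cells X M N (k + 1)"
      using ik i' by (elim cells_cases)
        (auto simp: degen_eq cells_def tuples_def edge_closed_simps dest: subsetD[OF set_dup])
  qed
next
  fix \<epsilon> :: sign and k i j :: nat and x :: "'m \<times> 'x list \<times> 'n"
  assume ij: "1 \<le> i \<and> i < j \<and> j \<le> k" and "x \<in> cells X M N k"
  then obtain m ys n where x: "x = (m, ys, n)" "m \<in> M" "n \<in> N" "set ys \<subseteq> X" "length ys = k"
    by (elim cells_cases)
  obtain i' j' where i': "i = Suc i'" and j': "j = Suc (Suc j')"
    using ij by (cases i; cases j; cases "j - 1") auto
  have l: "i' < k" "Suc j' < k" "i' \<le> j'" using ij i' j' by auto
  show "face X \<sigma> ra la \<epsilon> (k + 1) i (sg j x) = sg (j - 1) (face X \<sigma> ra la \<epsilon> k i x)"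
  proof (cases \<epsilon>)
    case Pos
    then show ?thesis
      using x l ra_rinv_dup_less[of i' "Suc j'" ys m] remove_dup_less[of i' "Suc j'" ys]
      by (simp add: face_def i' j' bd'_eq degen_eq edge_closed_simps)
  next
    \<comment> \<open>The contraction preserves the label of the repeated entry, so the same inverse
      action occurs on both sides.\<close>
    case Neg
    have "dup (Suc j') ys ! i' = ys ! i'" using x l by (simp add: nth_dup)
    with Neg show ?thesis
      using x l edge_reduce[of ys "Suc j'" i'] dup_reduce[of "Suc j'" i' ys]
      by (simp add: face_def i' j' bd_eq degen_eq edge_closed_simps shift_def)
  qed
next
  fix \<epsilon> :: sign and k i j :: nat and x :: "'m \<times> 'x list \<times> 'n"
  assume ij: "1 \<le> j \<and> j + 1 < i \<and> i \<le> k + 1" and "x \<in> cells X M N k"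
  then obtain m ys n where x: "x = (m, ys, n)" "m \<in> M" "n \<in> N" "set ys \<subseteq> X" "length ys = k"
    by (elim cells_cases)
  obtain i' j' where i': "i = Suc (Suc i')" and j': "j = Suc j'"
    using ij by (cases j; cases i; cases "i - 1") auto
  have l: "i' < k" "j' < i'" "j' < k" using ij i' j' by auto
  show "face X \<sigma> ra la \<epsilon> (k + 1) i (sg j x) = sg j (face X \<sigma> ra la \<epsilon> k (i - 1) x)"
  proof (cases \<epsilon>)
    case Pos
    then show ?thesis
      using x l ra_rinv_dup_greater[of j' i' ys m] remove_dup_greater[of j' i' ys]
      by (simp add: face_def i' j' bd'_eq degen_eq edge_closed_simps)
  next
    case Neg
    have "dup j' ys ! Suc i' = ys ! i'" using x l by (simp add: nth_dup)
    with Neg show ?thesis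
      using x l edge_reduce[of ys j' i'] dup_reduce[of j' i' ys]
      by (simp add: face_def i' j' bd_eq degen_eq edge_closed_simps shift_def)
  qed
next
  fix \<epsilon> :: sign and k i :: nat and x :: "'m \<times> 'x list \<times> 'n"
  assume ik: "1 \<le> i \<and> i \<le> k" and "x \<in> cells X M N k"
  then obtain m ys n where x: "x = (m, ys, n)" "m \<in> M" "n \<in> N" "set ys \<subseteq> X" "length ys = k"
    by (elim cells_cases)
  obtain i' where i': "i = Suc i'" using ik by (cases i) auto
  have l: "i' < k" using ik i' by simp
  show "face X \<sigma> ra la \<epsilon> (k + 1) i (sg i x) = face X \<sigma> ra la \<epsilon> (k + 1) (i + 1) (sg i x)"
  proof (cases \<epsilon>)
    case Pos
    then show ?thesis
      using x l
      by (simp add: face_def i' bd'_eq degen_eq edge_closed_simps edge_dup_self remove_dup_same)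
  next
    case Neg
    then show ?thesis
      using x l reduce_dup_self[of i' ys]
      by (simp add: face_def i' bd_eq degen_eq nth_dup)
  qed
next
  fix k i j :: nat and x :: "'m \<times> 'x list \<times> 'n"
  assume ij: "1 \<le> i \<and> i \<le> j \<and> j \<le> k" and "x \<in> cells X M N k"
  then obtain m ys n where x: "x = (m, ys, n)" "m \<in> M" "n \<in> N" "set ys \<subseteq> X" "length ys = k"
    by (elim cells_cases)
  obtain i' j' where i': "i = Suc i'" and j': "j = Suc j'"
    using ij by (cases i; cases j) auto
  have l: "i' < k" "j' < k" "i' \<le> j'" using ij i' j' by auto
  show "sg i (sg j x) = sg (j + 1) (sg i x)"
    using x l rinv_rinv_dup[of i' j' ys m] dup_dup[of i' j' ys]
    by (simp add: i' j' degen_eq edge_closed_simps)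
next
  fix k i :: nat and x :: "'m \<times> 'x list \<times> 'n"
  assume ik: "1 \<le> i \<and> i \<le> k" and "x \<in> cells X M N k"
  then obtain m ys n where x: "x = (m, ys, n)" "m \<in> M" "n \<in> N" "set ys \<subseteq> X" "length ys = k"
    by (elim cells_cases)
  obtain i' where i': "i = Suc i'" using ik by (cases i) auto
  have l: "i' < k" using ik i' by simp
  show "face X \<sigma> ra la Pos (k + 1) i (sg i x) = x" "face X \<sigma> ra la Pos (k + 1) (i + 1) (sg i x) = x"
    using x l
    by (simp_all add: face_def i' bd'_eq degen_eq edge_closed_simps edge_dup_self remove_dup_same)
qed

end

theorem theorem8p2:
  fixes X :: "'x set" and \<sigma> :: "'x \<times> 'x \<Rightarrow> 'x \<times> 'x" and t :: "'x \<Rightarrow> 'x"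
    and M :: "'m set" and ra :: "'m \<Rightarrow> 'x \<Rightarrow> 'm"
    and N :: "'n set" and la :: "'x \<Rightarrow> 'n \<Rightarrow> 'n"
  assumes "braided_set X \<sigma>"
    and "left_nondegenerate X \<sigma>"
    and "weakly_RI_compatible X \<sigma> t"
    and "solid_right_module X \<sigma> M ra"
    and "left_module X \<sigma> N la"
  shows "let C = cells X M N; d = face X \<sigma> ra la; s = (\<lambda>k. degen X \<sigma> M ra t) in
    semi_strong_skew_cubical C d s \<and>
    (\<forall>k. is_direct_sum (formal (C k) :: ('m \<times> 'x list \<times> 'n \<Rightarrow>\<^sub>0 'a::ab_group_add) set)
           (degenerate_chains C s k) (normalized_chains C d s k)) \<and>
    (\<forall>\<alpha> \<beta>. \<forall>k \<ge> 1.
       differential d \<alpha> \<beta> k ` (degenerate_chains C s k :: ('m \<times> 'x list \<times> 'n \<Rightarrow>\<^sub>0 'a) set)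
         \<subseteq> degenerate_chains C s (k - 1) \<and>
       differential d \<alpha> \<beta> k ` (normalized_chains C d s k :: ('m \<times> 'x list \<times> 'n \<Rightarrow>\<^sub>0 'a) set)
         \<subseteq> normalized_chains C d s (k - 1))"
proof -
  interpret RI_compatible_modules X \<sigma> t M ra N la
    using assms by unfold_locales
  \<comment> \<open>This transfers the abstract decomposition and its stability to the cells of the
    braided set.\<close>
  interpret skew_cubical "cells X M N" "face X \<sigma> ra la" "\<lambda>k. degen X \<sigma> M ra t"
    by unfold_locales (rule semi_strong_skew_cubical_cells)
  show ?thesis
    unfolding Let_def
    using cubical direct_sum differential_degenerate differential_normalized
    by (intro conjI allI impI image_subsetI) blast+
qed

end
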